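(* Let $\mathcal{F}\subset Hol(B(\mathcal{X})^n_1)$ be a family of free holomorphic functions. Then the following statements are equivalent: (i) $\sup_{f\in\mathcal{F}}\|f(rS_1,\ldots,rS_n)\|<\infty$ for each $r\in[0,1)$. (ii) $\mathcal{F}$ is a normal set. (iii) $\mathcal{F}$ is locally bounded.
   Context: $\mathbb{F}_n^+$ is the unital free semigroup on generators $g_1,\ldots,g_n$ with identity $g_0$; $|\alpha|$ is word length; $X_\alpha:=X_{i_1}\cdots X_{i_k}$ if $\alpha=g_{i_1}\cdots g_{i_k}$, $X_{g_0}:=I$. $Hol(B(\mathcal{X})^n_1)$ is the set of formal power series $F=\sum_\alpha a_\alpha Z_\alpha$, $a_\alpha\in\mathbb{C}$, in noncommuting indeterminates with $\limsup_{k\to\infty}(\sum_{|\alpha|=k}|a_\alpha|^2)^{1/2k}\le1$; then $F(X_1,\ldots,X_n):=\sum_{k=0}^\infty\sum_{|\alpha|=k}a_\alpha X_\alpha$ converges in norm whenever $X_i$ are operators on a Hilbert space with $\|\sum_iX_iX_i^*\|<1$. $S_1,\ldots,S_n$ are the left creation operators $S_i\xi:=e_i\otimes\xi$ on the full Fock space $F^2(H_n)=\mathbb{C}1\oplus\bigoplus_{m\ge1}H_n^{\otimes m}$, $H_n$ an $n$-dimensional Hilbert space with orthonormal basis $e_1,\ldots,e_n$. Let $\mathcal{H}$ be an infinite dimensional Hilbert space, and let $[B(\mathcal{H})^n]_r$ and $[B(\mathcal{H})^n]_r^-$ be the sets of $[X_1,\ldots,X_n]\in B(\mathcal{H})^n$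 with $\|\sum_iX_iX_i^*\|^{1/2}<r$, respectively $\le r$. $\mathcal{F}$ is normal if each sequence in $\mathcal{F}$ has a subsequence which converges to a function in $Hol(B(\mathcal{X})^n_1)$ uniformly (in operator norm) on $[B(\mathcal{H})^n]_r^-$ for every $r\in[0,1)$. $\mathcal{F}$ is locally bounded if for any $r\in[0,1)$ there exists $M>0$ such that $\|f(X_1,\ldots,X_n)\|\le M$ for any $f\in\mathcal{F}$ and $[X_1,\ldots,X_n]\in[B(\mathcal{H})^n]_r$. *)

theory Defs
  imports "HOL-Analysis.Analysis"
begin

section \<open>Complex Hilbert spaces\<close>

class complex_vector = real_vector +
  fixes scaleC :: "complex \<Rightarrow> 'a \<Rightarrow> 'a"  (infixr "*\<^sub>C" 75)
  assumes scaleC_add_right: "c *\<^sub>C (x + y) = c *\<^sub>C x + c *\<^sub>C y"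
    and scaleC_add_left: "(c + d) *\<^sub>C x = c *\<^sub>C x + d *\<^sub>C x"
    and scaleC_scaleC: "c *\<^sub>C d *\<^sub>C x = (c * d) *\<^sub>C x"
    and scaleC_one: "1 *\<^sub>C x = x"
    and scaleR_scaleC: "r *\<^sub>R x = complex_of_real r *\<^sub>C x"

text \<open>The inner product is linear in the first argument. Inheriting from \<^class>\<open>real_inner\<close>,
  with the real part of the complex inner product as real inner product, makes
  the norm the Hilbert space norm.\<close>

class complex_inner = complex_vector + real_inner +
  fixes cinner :: "'a \<Rightarrow> 'a \<Rightarrow> complex"
  assumes cinner_commute: "cinner x y = cnj (cinner y x)"
    and cinner_add_left: "cinner (x + y) z = cinner x z + cinner y z"
    and cinner_scaleC_left: "cinner (c *\<^sub>C x) y = c * cinner x y"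
    and inner_Re_cinner: "inner x y = Re (cinner x y)"

class complex_hilbert_space = complex_inner + complete_space

lemma vector_space_scaleC: "vector_space (scaleC :: complex \<Rightarrow> 'a::complex_vector \<Rightarrow> 'a)"
  by unfold_locales (auto simp: scaleC_add_right scaleC_add_left scaleC_scaleC scaleC_one)

definition infinite_dimensional :: "'a::complex_vector itself \<Rightarrow> bool" where
  "infinite_dimensional _ \<longleftrightarrow>
     \<not> (\<exists>B::'a set. finite B \<and> module.span scaleC B = UNIV)"

lemma cinner_scaleC_right: "cinner x (c *\<^sub>C y) = cnj c * cinner x y"
  by (subst (1 2) cinner_commute) (simp add: cinner_scaleC_left)

lemma cinner_add_right: "cinner x (y + z) = cinner x y + cinner x z"
  by (subst (1 2 3) cinner_commute) (simp add: cinner_add_left)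

lemma cinner_conv_inner: "cinner x y = Complex (inner x y) (inner x (\<i> *\<^sub>C y))"
  by (simp add: complex_eq_iff inner_Re_cinner cinner_scaleC_right)

lemma norm_scaleC: "norm (c *\<^sub>C x :: 'a::complex_inner) = cmod c * norm x"
proof -
  have "cinner (c *\<^sub>C x) (c *\<^sub>C x) = (c * cnj c) * cinner x x"
    by (simp add: cinner_scaleC_left cinner_scaleC_right)
  also have "c * cnj c = complex_of_real ((cmod c)\<^sup>2)" by (rule complex_norm_square[symmetric])
  finally have "inner (c *\<^sub>C x) (c *\<^sub>C x) = (cmod c)\<^sup>2 * inner x x"
    unfolding inner_Re_cinner by (simp only: times_complex.sel Re_complex_of_real Im_complex_of_real)
  thus ?thesis by (simp add: norm_eq_sqrt_inner real_sqrt_mult)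
qed


section \<open>Bounded operators\<close>

text \<open>The type of bounded operators in the library consists of the real-linear ones; \<open>B(H)\<close>
  is the set of those which are complex-linear.\<close>

definition clinear_op :: "('a::complex_inner \<Rightarrow>\<^sub>L 'b::complex_inner) \<Rightarrow> bool" where
  "clinear_op X \<longleftrightarrow> (\<forall>c x. blinfun_apply X (c *\<^sub>C x) = c *\<^sub>C blinfun_apply X x)"

lemma bounded_linear_scaleC: "bounded_linear (\<lambda>x::'a::complex_inner. c *\<^sub>C x)"
proof (rule bounded_linear_intro[where K = "cmod c"])
  show "c *\<^sub>C (r *\<^sub>R x) = r *\<^sub>R c *\<^sub>C x" for r and x :: 'a
    by (simp add: scaleR_scaleC scaleC_scaleC mult.commute)
qed (simp_all add: scaleC_add_right norm_scaleC mult.commute)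

instantiation blinfun :: (real_normed_vector, complex_inner) complex_vector
begin

definition scaleC_blinfun :: "complex \<Rightarrow> ('a \<Rightarrow>\<^sub>L 'b) \<Rightarrow> ('a \<Rightarrow>\<^sub>L 'b)" where
  "scaleC_blinfun c X = Blinfun (\<lambda>x. c *\<^sub>C blinfun_apply X x)"

lemma scaleC_blinfun_apply: "blinfun_apply (c *\<^sub>C (X :: 'a \<Rightarrow>\<^sub>L 'b)) x = c *\<^sub>C blinfun_apply X x"
  unfolding scaleC_blinfun_def
  by (subst bounded_linear_Blinfun_apply)
     (auto intro: bounded_linear_compose[OF bounded_linear_scaleC] blinfun.bounded_linear_right)

instance
  by standard
     (auto intro!: blinfun_eqI simp: scaleC_blinfun_apply blinfun.add_left blinfun.scaleR_left
        scaleC_add_right scaleC_add_left scaleC_scaleC scaleC_one scaleR_scaleC[where 'a = 'b])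

end

definition cadjoint ::
  "('a::complex_hilbert_space \<Rightarrow>\<^sub>L 'b::complex_hilbert_space) \<Rightarrow> 'b \<Rightarrow>\<^sub>L 'a" where
  "cadjoint X = (THE Y. \<forall>x y. cinner (blinfun_apply X x) y = cinner x (blinfun_apply Y y))"

text \<open>The definite description is proper for every \<^term>\<open>clinear_op X\<close>; this is the Riesz
  representation theorem.\<close>

lemma riesz_representation:
  fixes \<phi> :: "'a::{real_inner, complete_space} \<Rightarrow> real"
  assumes "bounded_linear \<phi>"
  shows "\<exists>y. \<forall>x. \<phi> x = inner y x"
proof -
  interpret bounded_linear \<phi> by fact
  define \<psi> where "\<psi> x = (norm x)\<^sup>2 - 2 * \<phi> x" for x
  obtain K where K: "\<And>x. \<bar>\<phi> x\<bar> \<le> norm x * K" using bounded by auto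
  have lb: "- K\<^sup>2 \<le> \<psi> x" for x
  proof -
    have "0 \<le> (norm x - K)\<^sup>2" by simp
    moreover have "\<phi> x \<le> norm x * K" using K[of x] by linarith
    ultimately show ?thesis by (simp add: \<psi>_def power2_diff)
  qed
  define m where "m = Inf (range \<psi>)"
  have bdd: "bdd_below (range \<psi>)" using lb by (intro bdd_belowI[of _ "- K\<^sup>2"]) auto
  have m_le: "m \<le> \<psi> x" for x unfolding m_def by (rule cInf_lower[OF _ bdd]) simp
  have "\<exists>x. \<psi> x < m + inverse (Suc n)" for n
  proof -
    have "Inf (range \<psi>) < m + inverse (Suc n)" unfolding m_def[symmetric] by simp
    thus ?thesis using cInf_less_iff[of "range \<psi>", OF _ bdd] by auto
  qed
  then obtain x where x: "\<And>n. \<psi> (x n) < m + inverse (Suc n)" by metis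
  have par: "(norm (u - v))\<^sup>2 = 2 * \<psi> u + 2 * \<psi> v - 4 * \<psi> ((1/2) *\<^sub>R (u + v))" for u v
    by (simp add: \<psi>_def scaleR add power_divide power2_norm_eq_inner inner_add_left inner_add_right
        inner_diff_left inner_diff_right inner_commute algebra_simps)
  have dist_x: "(norm (x i - x j))\<^sup>2 < 4 * inverse (Suc n)" if "i \<ge> n" "j \<ge> n" for i j n
  proof -
    have "inverse (real (Suc i)) \<le> inverse (Suc n)" "inverse (real (Suc j)) \<le> inverse (Suc n)"
      using that by (auto simp: field_simps)
    thus ?thesis using x[of i] x[of j] m_le[of "(1/2) *\<^sub>R (x i + x j)"] unfolding par by linarith
  qed
  have "Cauchy x"
  proof (rule metric_CauchyI)
    fix e :: real assume "e > 0"
    then obtain n where n: "inverse (Suc n) < e\<^sup>2 / 4"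
      using reals_Archimedean[of "e\<^sup>2 / 4"] by auto
    have "dist (x i) (x j) < e" if "i \<ge> n" "j \<ge> n" for i j
    proof (rule power2_less_imp_less)
      show "(dist (x i) (x j))\<^sup>2 < e\<^sup>2" using dist_x[OF that] n unfolding dist_norm by linarith
    qed (use \<open>e > 0\<close> in simp)
    thus "\<exists>M. \<forall>i\<ge>M. \<forall>j\<ge>M. dist (x i) (x j) < e" by blast
  qed
  then obtain y where y: "x \<longlonglongrightarrow> y" using Cauchy_convergent convergent_def by blast
  have "(\<lambda>n. \<psi> (x n)) \<longlonglongrightarrow> \<psi> y" unfolding \<psi>_def by (intro tendsto_intros tendsto y)
  moreover have "(\<lambda>n. m + inverse (real (Suc n))) \<longlonglongrightarrow> m + 0"
    by (intro tendsto_intros LIMSEQ_inverse_real_of_nat)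
  ultimately have "\<psi> y \<le> m + 0"
    by (rule LIMSEQ_le) (use x less_imp_le in blast)
  have "\<phi> z = inner y z" for z
  proof (rule ccontr)
    assume neq: "\<phi> z \<noteq> inner y z"
    define d where "d = inner y z - \<phi> z"
    have "z \<noteq> 0" using neq zero by auto
    define t where "t = - d / (norm z)\<^sup>2"
    have "\<psi> (y + t *\<^sub>R z) = \<psi> y + 2 * t * d + t\<^sup>2 * (norm z)\<^sup>2"
      unfolding \<psi>_def d_def scaleR add power2_norm_eq_inner
      by (simp add: inner_add_left inner_add_right inner_commute power2_eq_square algebra_simps)
    also have "\<dots> = \<psi> y - d\<^sup>2 / (norm z)\<^sup>2"
      using \<open>z \<noteq> 0\<close> by (simp add: t_def field_simps power2_eq_square)
    also have "\<dots> < \<psi> y" using neq \<open>z \<noteq> 0\<close> by (simp add: d_def)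
    finally show False using m_le[of "y + t *\<^sub>R z"] \<open>\<psi> y \<le> m + 0\<close> by simp
  qed
  thus ?thesis by blast
qed

lemma cadjoint_exists:
  fixes X :: "'a::complex_hilbert_space \<Rightarrow>\<^sub>L 'b::complex_hilbert_space"
  assumes "clinear_op X"
  shows "\<exists>!Y. \<forall>x y. cinner (blinfun_apply X x) y = cinner x (blinfun_apply Y y)"
proof -
  have "\<exists>z. \<forall>x. inner (blinfun_apply X x) y = inner z x" for y
    by (rule riesz_representation)
       (auto intro: bounded_linear_compose[OF bounded_linear_inner_left] blinfun.bounded_linear_right)
  then obtain g where g: "\<And>x y. inner (blinfun_apply X x) y = inner x (g y)"
    by (metis inner_commute)
  have eqI: "u = v" if "\<And>x. inner x u = inner x v" for u v :: 'a
  proof -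
    have "inner (u - v) (u - v) = 0" using that by (simp add: inner_diff_right)
    thus ?thesis by simp
  qed
  have "bounded_linear g"
  proof (rule bounded_linear_intro[where K = "norm X"])
    show "g (u + v) = g u + g v" for u v
      by (rule eqI) (simp add: g[symmetric] inner_add_right)
    show "g (r *\<^sub>R u) = r *\<^sub>R g u" for r u
      by (rule eqI) (simp add: g[symmetric])
    show "norm (g u) \<le> norm u * norm X" for u
    proof (cases "g u = 0")
      case False
      have "norm (g u) * norm (g u) = inner (blinfun_apply X (g u)) u"
        by (simp add: g power2_norm_eq_inner[symmetric] power2_eq_square)
      also have "\<dots> \<le> norm (blinfun_apply X (g u)) * norm u" by (rule norm_cauchy_schwarz)
      also have "\<dots> \<le> (norm X * norm (g u)) * norm u"
        by (intro mult_right_mono norm_blinfun) simp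
      finally show ?thesis using False by (simp add: mult_ac)
    qed simp
  qed
  define Y where "Y = Blinfun g"
  have Y: "blinfun_apply Y = g" unfolding Y_def by (rule bounded_linear_Blinfun_apply) fact
  have "cinner (blinfun_apply X x) y = cinner x (g y)" for x y
  proof -
    have ic: "inner (c *\<^sub>C u) v = inner u (cnj c *\<^sub>C v)" for c and u v :: "'c::complex_inner"
      by (simp add: inner_Re_cinner cinner_scaleC_left cinner_scaleC_right)
    have "inner (blinfun_apply X x) (\<i> *\<^sub>C y) = inner (blinfun_apply X (cnj \<i> *\<^sub>C x)) y"
      using assms by (simp add: clinear_op_def ic)
    also have "\<dots> = inner x (\<i> *\<^sub>C g y)" by (simp only: g ic complex_cnj_cnj)
    finally show ?thesis by (simp add: cinner_conv_inner g)
  qed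
  moreover have "Z = Y"
    if "\<forall>x y. cinner (blinfun_apply X x) y = cinner x (blinfun_apply Z y)" for Z
    by (intro blinfun_eqI eqI) (metis that inner_Re_cinner g Y)
  ultimately show ?thesis using Y by metis
qed


section \<open>The full Fock space\<close>

text \<open>Words in the generators \<open>g\<^sub>i\<close>, \<open>i :: 'n\<close>, are lists. The Hilbert space \<open>H\<^sub>n\<close> is \<^typ>\<open>complex^'n\<close>
  with its standard basis, and an element of the \<open>m\<close>-th tensor power of \<open>H\<^sub>n\<close> is given by its
  coordinates with respect to the orthonormal basis \<open>e\<^sub>w = e\<^bsub>i1\<^esub> \<otimes> \<dots> \<otimes> e\<^bsub>im\<^esub>\<close>, indexed by the words
  of length \<open>m\<close>; for \<open>m = 0\<close> this is the summand of scalars. Hence the Hilbert space direct sum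
  consists of the square-summable families of coordinates indexed by all words.\<close>

typedef 'n fock = "{f :: 'n list \<Rightarrow> complex. (\<lambda>w. (cmod (f w))\<^sup>2) summable_on UNIV}"
  morphisms fock_coeff Abs_fock
  by (rule exI[of _ "\<lambda>_. 0"]) simp

setup_lifting type_definition_fock

lemma fock_eqI: "(\<And>w. fock_coeff \<xi> w = fock_coeff \<eta> w) \<Longrightarrow> \<xi> = \<eta>"
  by (metis ext fock_coeff_inject)

lemma sq_summable_fock: "(\<lambda>w. (cmod (fock_coeff \<xi> w))\<^sup>2) summable_on UNIV"
  using fock_coeff by auto

lemma sq_summable_add:
  fixes f g :: "'a \<Rightarrow> complex"
  assumes "(\<lambda>w. (cmod (f w))\<^sup>2) summable_on A" "(\<lambda>w. (cmod (g w))\<^sup>2) summable_on A"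
  shows "(\<lambda>w. (cmod (f w + g w))\<^sup>2) summable_on A"
proof (rule summable_on_comparison_test)
  show "(\<lambda>w. 2 * (cmod (f w))\<^sup>2 + 2 * (cmod (g w))\<^sup>2) summable_on A"
    by (intro summable_on_add summable_on_cmult_right assms)
  show "(cmod (f w + g w))\<^sup>2 \<le> 2 * (cmod (f w))\<^sup>2 + 2 * (cmod (g w))\<^sup>2" for w
  proof -
    have "(cmod (f w + g w))\<^sup>2 \<le> (cmod (f w) + cmod (g w))\<^sup>2"
      by (intro power_mono norm_triangle_ineq) simp
    also have "\<dots> \<le> 2 * (cmod (f w))\<^sup>2 + 2 * (cmod (g w))\<^sup>2"
      using sum_squares_bound[of "cmod (f w)" "cmod (g w)"] by (simp add: power2_sum)
    finally show ?thesis .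
  qed
qed simp

lemma sq_summable_cmult:
  fixes f :: "'a \<Rightarrow> complex"
  assumes "(\<lambda>w. (cmod (f w))\<^sup>2) summable_on A"
  shows "(\<lambda>w. (cmod (c * f w))\<^sup>2) summable_on A"
  using assms by (simp add: norm_mult power_mult_distrib summable_on_cmult_right)

lemma summable_cinner_fock:
  "(\<lambda>w. fock_coeff \<xi> w * cnj (fock_coeff \<eta> w)) summable_on UNIV"
proof (rule Infinite_Sum.abs_summable_summable[OF Infinite_Sum.abs_summable_on_comparison_test'])
  show "(\<lambda>w. (cmod (fock_coeff \<xi> w))\<^sup>2 + (cmod (fock_coeff \<eta> w))\<^sup>2) summable_on UNIV"
    by (intro summable_on_add sq_summable_fock)
  show "cmod (fock_coeff \<xi> w * cnj (fock_coeff \<eta> w))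
      \<le> (cmod (fock_coeff \<xi> w))\<^sup>2 + (cmod (fock_coeff \<eta> w))\<^sup>2" for w
    using sum_squares_bound[of "cmod (fock_coeff \<xi> w)" "cmod (fock_coeff \<eta> w)"]
      mult_nonneg_nonneg[OF norm_ge_zero norm_ge_zero, of "fock_coeff \<xi> w" "fock_coeff \<eta> w"]
    unfolding norm_mult complex_mod_cnj by linarith
qed

instantiation fock :: (type) complex_vector
begin

lift_definition zero_fock :: "'a fock" is "\<lambda>_. 0" by simp

lift_definition plus_fock :: "'a fock \<Rightarrow> 'a fock \<Rightarrow> 'a fock" is "\<lambda>f g w. f w + g w"
  by (rule sq_summable_add)

lift_definition uminus_fock :: "'a fock \<Rightarrow> 'a fock" is "\<lambda>f w. - f w" by simp

definition minus_fock :: "'a fock \<Rightarrow> 'a fock \<Rightarrow> 'a fock" where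
  "\<xi> - \<eta> = \<xi> + - (\<eta> :: 'a fock)"

lift_definition scaleC_fock :: "complex \<Rightarrow> 'a fock \<Rightarrow> 'a fock" is "\<lambda>c f w. c * f w"
  by (rule sq_summable_cmult)

definition scaleR_fock :: "real \<Rightarrow> 'a fock \<Rightarrow> 'a fock" where
  "r *\<^sub>R \<xi> = complex_of_real r *\<^sub>C (\<xi> :: 'a fock)"

instance
  by standard
     (auto intro!: fock_eqI simp: zero_fock.rep_eq plus_fock.rep_eq uminus_fock.rep_eq minus_fock_def
        scaleC_fock.rep_eq scaleR_fock_def algebra_simps)

end

lemma fock_coeff_minus: "fock_coeff (\<xi> - \<eta>) w = fock_coeff \<xi> w - fock_coeff \<eta> w"
  unfolding minus_fock_def plus_fock.rep_eq uminus_fock.rep_eq by simp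

instantiation fock :: (type) complex_inner
begin

definition cinner_fock :: "'a fock \<Rightarrow> 'a fock \<Rightarrow> complex" where
  "cinner \<xi> \<eta> = (\<Sum>\<^sub>\<infinity>w. fock_coeff \<xi> w * cnj (fock_coeff \<eta> w))"

definition inner_fock :: "'a fock \<Rightarrow> 'a fock \<Rightarrow> real" where
  "inner \<xi> \<eta> = Re (cinner \<xi> (\<eta> :: 'a fock))"

definition norm_fock :: "'a fock \<Rightarrow> real" where
  "norm \<xi> = sqrt (inner \<xi> (\<xi> :: 'a fock))"

definition sgn_fock :: "'a fock \<Rightarrow> 'a fock" where
  "sgn \<xi> = inverse (norm \<xi>) *\<^sub>R (\<xi> :: 'a fock)"

definition dist_fock :: "'a fock \<Rightarrow> 'a fock \<Rightarrow> real" where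
  "dist \<xi> \<eta> = norm (\<xi> - (\<eta> :: 'a fock))"

definition uniformity_fock :: "('a fock \<times> 'a fock) filter" where
  "uniformity_fock = (INF e\<in>{0 <..}. principal {(\<xi>, \<eta>). dist \<xi> (\<eta> :: 'a fock) < e})"

definition open_fock :: "'a fock set \<Rightarrow> bool" where
  "open_fock U \<longleftrightarrow> (\<forall>\<xi>\<in>U. eventually (\<lambda>(\<xi>', \<eta>). \<xi>' = \<xi> \<longrightarrow> \<eta> \<in> U) uniformity)"

lemma inner_fock_self: "inner \<xi> (\<xi> :: 'a fock) = (\<Sum>\<^sub>\<infinity>w. (cmod (fock_coeff \<xi> w))\<^sup>2)"
proof -
  have "inner \<xi> \<xi> = (\<Sum>\<^sub>\<infinity>w. Re (fock_coeff \<xi> w * cnj (fock_coeff \<xi> w)))"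
    unfolding inner_fock_def cinner_fock_def by (rule infsum_Re[symmetric, OF summable_cinner_fock])
  also have "\<dots> = (\<Sum>\<^sub>\<infinity>w. (cmod (fock_coeff \<xi> w))\<^sup>2)"
    by (simp only: complex_norm_square[symmetric] Re_complex_of_real)
  finally show ?thesis .
qed

instance
proof
  fix \<xi> \<eta> \<zeta> :: "'a fock" and r :: real and c :: complex and U :: "'a fock set"
  show c: "cinner \<xi> \<eta> = cnj (cinner \<eta> \<xi>)" for \<xi> \<eta> :: "'a fock"
    unfolding cinner_fock_def infsum_cnj[symmetric] by (simp add: mult.commute)
  show a: "cinner (\<xi> + \<eta>) \<zeta> = cinner \<xi> \<zeta> + cinner \<eta> \<zeta>"
    unfolding cinner_fock_def plus_fock.rep_eq distrib_right
    by (intro infsum_add summable_cinner_fock)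
  show s: "cinner (c *\<^sub>C \<xi>) \<eta> = c * cinner \<xi> \<eta>" for c and \<xi> \<eta> :: "'a fock"
    unfolding cinner_fock_def scaleC_fock.rep_eq mult.assoc by (rule infsum_cmult_right')
  show "inner \<xi> \<eta> = Re (cinner \<xi> \<eta>)" by (rule inner_fock_def)
  show "inner \<xi> \<eta> = inner \<eta> \<xi>" unfolding inner_fock_def by (subst c) simp
  show "inner (\<xi> + \<eta>) \<zeta> = inner \<xi> \<zeta> + inner \<eta> \<zeta>" by (simp add: inner_fock_def a)
  show "inner (r *\<^sub>R \<xi>) \<eta> = r * inner \<xi> \<eta>" by (simp add: inner_fock_def scaleR_fock_def s)
  show "0 \<le> inner \<xi> \<xi>" unfolding inner_fock_self by (rule infsum_nonneg) simp
  show "inner \<xi> \<xi> = 0 \<longleftrightarrow> \<xi> = 0"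
  proof
    assume "inner \<xi> \<xi> = 0"
    hence "(cmod (fock_coeff \<xi> w))\<^sup>2 = 0" for w
      by (intro nonneg_infsum_le_0D[where A = UNIV and f = "\<lambda>w. (cmod (fock_coeff \<xi> w))\<^sup>2"])
         (auto simp: inner_fock_self sq_summable_fock)
    thus "\<xi> = 0" by (intro fock_eqI) (simp add: zero_fock.rep_eq)
  qed (simp add: inner_fock_self zero_fock.rep_eq)
qed (rule norm_fock_def sgn_fock_def dist_fock_def uniformity_fock_def open_fock_def)+

end

lemma norm_fock_sq: "(norm \<xi>)\<^sup>2 = (\<Sum>\<^sub>\<infinity>w. (cmod (fock_coeff \<xi> w))\<^sup>2)"
  unfolding power2_norm_eq_inner[of \<xi>] by (rule inner_fock_self)

instance fock :: (type) complex_hilbert_space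
proof
  fix X :: "nat \<Rightarrow> 'a fock"
  assume X: "Cauchy X"
  have sum_le: "(\<Sum>w\<in>F. (cmod (fock_coeff \<xi> w))\<^sup>2) \<le> (norm \<xi>)\<^sup>2" if "finite F" for F and \<xi> :: "'a fock"
    unfolding norm_fock_sq by (intro finite_sum_le_infsum sq_summable_fock that) auto
  have coeff_le: "cmod (fock_coeff \<xi> w) \<le> norm \<xi>" for w and \<xi> :: "'a fock"
    by (rule power2_le_imp_le) (use sum_le[of "{w}" \<xi>] in auto)
  have "\<exists>l. (\<lambda>n. fock_coeff (X n) w) \<longlonglongrightarrow> l" for w
  proof -
    have "Cauchy (\<lambda>n. fock_coeff (X n) w)"
    proof (rule metric_CauchyI)
      fix e :: real assume "e > 0"
      then obtain M where "\<And>i j. i \<ge> M \<Longrightarrow> j \<ge> M \<Longrightarrow> dist (X i) (X j) < e"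
        using metric_CauchyD[OF X] by blast
      moreover have "dist (fock_coeff (X i) w) (fock_coeff (X j) w) \<le> dist (X i) (X j)" for i j
        using coeff_le[of "X i - X j" w] by (simp add: dist_norm fock_coeff_minus)
      ultimately show "\<exists>M. \<forall>i\<ge>M. \<forall>j\<ge>M. dist (fock_coeff (X i) w) (fock_coeff (X j) w) < e"
        by (meson le_less_trans)
    qed
    thus ?thesis using Cauchy_convergent convergent_def by blast
  qed
  then obtain l where l: "\<And>w. (\<lambda>n. fock_coeff (X n) w) \<longlonglongrightarrow> l w" by metis
  have tail: "(\<Sum>w\<in>F. (cmod (fock_coeff (X i) w - l w))\<^sup>2) \<le> e\<^sup>2"
    if "finite F" and M: "\<And>j. j \<ge> M \<Longrightarrow> dist (X i) (X j) < e" for F i M e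
  proof (rule LIMSEQ_le_const2)
    show "(\<lambda>j. \<Sum>w\<in>F. (cmod (fock_coeff (X i) w - fock_coeff (X j) w))\<^sup>2)
        \<longlonglongrightarrow> (\<Sum>w\<in>F. (cmod (fock_coeff (X i) w - l w))\<^sup>2)"
      by (intro tendsto_intros l)
    have "(\<Sum>w\<in>F. (cmod (fock_coeff (X i) w - fock_coeff (X j) w))\<^sup>2) \<le> e\<^sup>2" if "j \<ge> M" for j
    proof -
      have "(\<Sum>w\<in>F. (cmod (fock_coeff (X i - X j) w))\<^sup>2) \<le> (norm (X i - X j))\<^sup>2"
        by (rule sum_le) fact
      also have "\<dots> \<le> e\<^sup>2" using M[OF that] by (intro power_mono) (auto simp: dist_norm)
      finally show ?thesis by (simp add: fock_coeff_minus)
    qed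
    thus "\<exists>N. \<forall>j\<ge>N. (\<Sum>w\<in>F. (cmod (fock_coeff (X i) w - fock_coeff (X j) w))\<^sup>2) \<le> e\<^sup>2" by blast
  qed
  have tail_summable: "(\<lambda>w. (cmod (fock_coeff (X i) w - l w))\<^sup>2) summable_on UNIV"
    if M: "\<And>j. j \<ge> M \<Longrightarrow> dist (X i) (X j) < e" for i M e
    by (rule nonneg_bdd_above_summable_on)
       (auto intro!: bdd_aboveI[of _ "e\<^sup>2"] tail[OF _ M])
  obtain M where M: "\<And>i j. i \<ge> M \<Longrightarrow> j \<ge> M \<Longrightarrow> dist (X i) (X j) < 1"
    using metric_CauchyD[OF X, of 1] by auto
  have "(\<lambda>w. (cmod (- 1 * (fock_coeff (X M) w - l w) + fock_coeff (X M) w))\<^sup>2) summable_on UNIV"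
    by (intro sq_summable_add sq_summable_cmult sq_summable_fock tail_summable[OF M]) auto
  hence "(\<lambda>w. (cmod (l w))\<^sup>2) summable_on UNIV" by simp
  then obtain L where L: "fock_coeff L = l" using fock_coeff_cases[of l] by auto
  have "X \<longlonglongrightarrow> L"
  proof (rule metric_LIMSEQ_I)
    fix e :: real assume "e > 0"
    then obtain M where M: "\<And>i j. i \<ge> M \<Longrightarrow> j \<ge> M \<Longrightarrow> dist (X i) (X j) < e / 2"
      using metric_CauchyD[OF X, of "e / 2"] by auto
    have "dist (X i) L < e" if "i \<ge> M" for i
    proof -
      have "(norm (X i - L))\<^sup>2 \<le> (e / 2)\<^sup>2"
        unfolding norm_fock_sq
        by (intro infsum_le_finite_sums sq_summable_fock)
           (use tail[OF _ M[OF that]] in \<open>auto simp: fock_coeff_minus L\<close>)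
      hence "norm (X i - L) \<le> e / 2" by (rule power2_le_imp_le) (use \<open>e > 0\<close> in simp)
      thus ?thesis using \<open>e > 0\<close> by (simp add: dist_norm)
    qed
    thus "\<exists>M. \<forall>i\<ge>M. dist (X i) L < e" by blast
  qed
  thus "convergent X" by (auto simp: convergent_def)
qed

text \<open>The tensor product of \<open>x\<close> in \<open>H\<^sub>n\<close> with \<open>\<xi>\<close> in the Fock space, in coordinates.\<close>

lemma has_sum_words:
  fixes f :: "'n::finite list \<Rightarrow> 'b::{topological_comm_monoid_add, t2_space}"
  assumes "\<And>i. ((\<lambda>w. f (i # w)) has_sum s i) UNIV"
  shows "(f has_sum (f [] + (\<Sum>i\<in>UNIV. s i))) UNIV"
proof -
  have *: "(f has_sum s i) (range ((#) i))" for i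
    using assms[of i] by (subst has_sum_reindex) (auto simp: o_def)
  have "(f has_sum (\<Sum>i\<in>I. s i)) (\<Union>i\<in>I. range ((#) i))" if "finite I" for I
    using that
  proof induction
    case (insert i I)
    have "(f has_sum (s i + (\<Sum>i\<in>I. s i))) (range ((#) i) \<union> (\<Union>i\<in>I. range ((#) i)))"
      by (intro has_sum_Un_disjoint * insert.IH) (use insert.hyps in auto)
    thus ?case using insert.hyps by simp
  qed simp
  from this[of UNIV] have "(f has_sum (\<Sum>i\<in>UNIV. s i)) (\<Union>i. range ((#) i))" by simp
  moreover have "(f has_sum f []) {[]}" by (simp add: has_sum_finite_iff)
  ultimately have "(f has_sum (f [] + (\<Sum>i\<in>UNIV. s i))) ({[]} \<union> (\<Union>i. range ((#) i)))"
    by (intro has_sum_Un_disjoint) auto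
  moreover have "w \<in> {[]} \<union> (\<Union>i. range ((#) i))" for w :: "'n list"
    by (cases w) auto
  hence "{[]} \<union> (\<Union>i. range ((#) i)) = (UNIV :: 'n list set)" by blast
  ultimately show ?thesis by simp
qed

lift_definition fock_tensor :: "complex^'n::finite \<Rightarrow> 'n fock \<Rightarrow> 'n fock"  (infixr "\<otimes>\<^sub>F" 70)
  is "\<lambda>x f w. case w of [] \<Rightarrow> 0 | i # v \<Rightarrow> x $ i * f v"
proof -
  fix x :: "complex^'n" and f :: "'n list \<Rightarrow> complex"
  assume "(\<lambda>w. (cmod (f w))\<^sup>2) summable_on UNIV"
  hence "(\<lambda>w. (cmod (x $ i * f w))\<^sup>2) summable_on UNIV" for i by (rule sq_summable_cmult)
  hence "((\<lambda>w. (cmod (x $ i * f w))\<^sup>2) has_sum (\<Sum>\<^sub>\<infinity>w. (cmod (x $ i * f w))\<^sup>2)) UNIV" for i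
    by (rule has_sum_infsum)
  from has_sum_words[where f = "\<lambda>w. (cmod (case w of [] \<Rightarrow> 0 | i # v \<Rightarrow> x $ i * f v))\<^sup>2", simplified,
      OF this]
  show "(\<lambda>w. (cmod (case w of [] \<Rightarrow> 0 | i # v \<Rightarrow> x $ i * f v))\<^sup>2) summable_on UNIV"
    by (rule has_sum_imp_summable)
qed

lemma cinner_fock_tensor:
  "cinner (x \<otimes>\<^sub>F \<xi>) (y \<otimes>\<^sub>F \<eta>) = (\<Sum>i\<in>UNIV. x $ i * cnj (y $ i)) * cinner \<xi> \<eta>"
proof -
  have "((\<lambda>w. fock_coeff \<xi> w * cnj (fock_coeff \<eta> w)) has_sum cinner \<xi> \<eta>) UNIV"
    unfolding cinner_fock_def by (rule has_sum_infsum[OF summable_cinner_fock])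
  hence "((\<lambda>w. fock_coeff (x \<otimes>\<^sub>F \<xi>) (i # w) * cnj (fock_coeff (y \<otimes>\<^sub>F \<eta>) (i # w)))
      has_sum (x $ i * cnj (y $ i) * cinner \<xi> \<eta>)) UNIV" for i
    using has_sum_cmult_right[where c = "x $ i * cnj (y $ i)"]
    by (fastforce simp: fock_tensor.rep_eq mult_ac)
  from has_sum_words[OF this, THEN infsumI] show ?thesis
    unfolding cinner_fock_def[of "x \<otimes>\<^sub>F \<xi>"] by (simp add: fock_tensor.rep_eq sum_distrib_right)
qed

lemma bounded_linear_fock_tensor: "bounded_linear (\<lambda>\<xi>. x \<otimes>\<^sub>F \<xi>)"
proof (rule bounded_linear_intro[where K = "sqrt (Re (\<Sum>i\<in>UNIV. x $ i * cnj (x $ i)))"])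
  show "x \<otimes>\<^sub>F (\<xi> + \<eta>) = x \<otimes>\<^sub>F \<xi> + x \<otimes>\<^sub>F \<eta>" for \<xi> \<eta>
    by (rule fock_eqI) (auto simp: fock_tensor.rep_eq plus_fock.rep_eq algebra_simps split: list.split)
  show "x \<otimes>\<^sub>F (r *\<^sub>R \<xi>) = r *\<^sub>R (x \<otimes>\<^sub>F \<xi>)" for r \<xi>
    by (rule fock_eqI)
       (auto simp: fock_tensor.rep_eq scaleR_fock_def scaleC_fock.rep_eq split: list.split)
  have "Im (\<Sum>i\<in>UNIV. x $ i * cnj (x $ i)) = 0" by simp
  thus "norm (x \<otimes>\<^sub>F \<xi>) \<le> norm \<xi> * sqrt (Re (\<Sum>i\<in>UNIV. x $ i * cnj (x $ i)))" for \<xi>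
    by (simp add: norm_fock_def inner_fock_def cinner_fock_tensor real_sqrt_mult mult.commute
        del: Im_sum Re_sum)
qed

definition left_creation :: "'n::finite \<Rightarrow> 'n fock \<Rightarrow>\<^sub>L 'n fock" where
  "left_creation i = Blinfun (\<lambda>\<xi>. axis i 1 \<otimes>\<^sub>F \<xi>)"

lemma left_creation_apply: "blinfun_apply (left_creation i) \<xi> = axis i 1 \<otimes>\<^sub>F \<xi>"
  unfolding left_creation_def by (simp add: bounded_linear_Blinfun_apply bounded_linear_fock_tensor)

lemma clinear_left_creation: "clinear_op (left_creation i)"
  unfolding clinear_op_def left_creation_apply
  by (auto intro!: fock_eqI simp: fock_tensor.rep_eq scaleC_fock.rep_eq split: list.split)


section \<open>Free holomorphic functions\<close>

text \<open>A formal power series is identified with its family of coefficients.\<close>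

type_synonym 'n free_series = "'n list \<Rightarrow> complex"

definition free_hol :: "'n::finite free_series set" where
  "free_hol = {a. limsup (\<lambda>k. ereal ((\<Sum>w | length w = k. (cmod (a w))\<^sup>2) powr (1 / (2 * real k)))) \<le> 1}"

primrec word_op :: "('n \<Rightarrow> 'h \<Rightarrow>\<^sub>L 'h) \<Rightarrow> 'n list \<Rightarrow> 'h::real_normed_vector \<Rightarrow>\<^sub>L 'h" where
  "word_op X [] = id_blinfun"
| "word_op X (i # w) = X i o\<^sub>L word_op X w"

definition free_eval :: "'n::finite free_series \<Rightarrow> ('n \<Rightarrow> 'h \<Rightarrow>\<^sub>L 'h) \<Rightarrow> 'h::complex_hilbert_space \<Rightarrow>\<^sub>L 'h" where
  "free_eval a X = (\<Sum>k. \<Sum>w | length w = k. a w *\<^sub>C word_op X w)"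

definition row_norm :: "('n::finite \<Rightarrow> 'h \<Rightarrow>\<^sub>L 'h::complex_hilbert_space) \<Rightarrow> real" where
  "row_norm X = sqrt (norm (\<Sum>i\<in>UNIV. X i o\<^sub>L cadjoint (X i)))"

definition open_op_ball :: "real \<Rightarrow> ('n::finite \<Rightarrow> 'h \<Rightarrow>\<^sub>L 'h::complex_hilbert_space) set" where
  "open_op_ball r = {X. (\<forall>i. clinear_op (X i)) \<and> row_norm X < r}"

definition closed_op_ball :: "real \<Rightarrow> ('n::finite \<Rightarrow> 'h \<Rightarrow>\<^sub>L 'h::complex_hilbert_space) set" where
  "closed_op_ball r = {X. (\<forall>i. clinear_op (X i)) \<and> row_norm X \<le> r}"

text \<open>The type argument is the Hilbert space on which the functions are evaluated.\<close>

definition normal_family ::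
  "'h::complex_hilbert_space itself \<Rightarrow> 'n::finite free_series set \<Rightarrow> bool" where
  "normal_family _ \<F> \<longleftrightarrow>
     (\<forall>f :: nat \<Rightarrow> 'n free_series. range f \<subseteq> \<F> \<longrightarrow>
        (\<exists>(s :: nat \<Rightarrow> nat) g. strict_mono s \<and> g \<in> free_hol \<and>
           (\<forall>r\<in>{0..<1}. uniform_limit (closed_op_ball r :: ('n \<Rightarrow> 'h \<Rightarrow>\<^sub>L 'h) set)
              (\<lambda>k. free_eval (f (s k))) (free_eval g) sequentially)))"

definition locally_bounded ::
  "'h::complex_hilbert_space itself \<Rightarrow> 'n::finite free_series set \<Rightarrow> bool" where
  "locally_bounded _ \<F> \<longleftrightarrow>
     (\<forall>r\<in>{0..<1}. \<exists>M>0. \<forall>f\<in>\<F>. \<forall>X\<in>(open_op_ball r :: ('n \<Rightarrow> 'h \<Rightarrow>\<^sub>L 'h) set).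
        norm (free_eval f X) \<le> M)"

end

theory Submission
  imports Defs "HOL-Complex_Analysis.Great_Picard"
begin

text \<open>Let \<open>\<parallel>f\<parallel>\<^sub>k\<close> be the \<open>\<ell>\<^sup>2\<close> norm of the coefficients of \<open>f\<close> on the words of length \<open>k\<close>. All three
  conditions are equivalent to the boundedness of \<open>\<parallel>f\<parallel>\<^sub>k r\<^sup>k\<close> in \<open>f\<close> and \<open>k\<close> for every \<open>r < 1\<close>.
  The homogeneous part of degree \<open>k\<close> has norm at most \<open>\<parallel>f\<parallel>\<^sub>k r\<^sup>k\<close> on the ball of radius \<open>r\<close>, so
  coefficient bounds give bounds of the values as well as, by a diagonal sequence of coefficients and
  dominated convergence, normality. Conversely, applying \<open>f(rS)\<close> to the vacuum vector recovers the
  coefficients; on an arbitrary infinite dimensional space the left creation operators are replaced by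
  their truncations to the words of bounded length. Finally, a normal family is locally bounded because
  a locally uniform limit is.\<close>

section \<open>Orthonormal families\<close>

instance complex_hilbert_space \<subseteq> banach ..

lemma cinner_zero_left [simp]: "cinner 0 x = 0"
  and cinner_zero_right [simp]: "cinner x 0 = 0"
  using cinner_add_left[of 0 0 x] cinner_add_right[of x 0 0] by simp_all

lemma scaleC_zero_right [simp]: "c *\<^sub>C 0 = (0 :: 'a::complex_vector)"
  using scaleC_add_right[of c 0 "0 :: 'a"] by simp

lemma scaleC_zero_left [simp]: "0 *\<^sub>C x = (0 :: 'a::complex_vector)"
  using scaleC_add_left[of 0 0 x] by simp

lemma cinner_sum_left: "cinner (\<Sum>i\<in>A. f i) y = (\<Sum>i\<in>A. cinner (f i) y)"
  by (induction A rule: infinite_finite_induct) (simp_all add: cinner_add_left)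

lemma bounded_linear_cinner_left: "bounded_linear (\<lambda>x. cinner x y)"
\<comment> \<open>The two summands of the constant bound the real and the imaginary part, which are
  the real inner products with \<open>y\<close> and \<open>\<i> *\<^sub>C y\<close>.\<close>
proof (rule bounded_linear_intro[where K = "norm y + norm (\<i> *\<^sub>C y)"])
  show "cmod (cinner x y) \<le> norm x * (norm y + norm (\<i> *\<^sub>C y))" for x
    using cmod_le[of "cinner x y"] Cauchy_Schwarz_ineq2[of x y] Cauchy_Schwarz_ineq2[of x "\<i> *\<^sub>C y"]
    by (simp add: cinner_conv_inner algebra_simps)
qed (simp_all add: cinner_add_left scaleR_scaleC cinner_scaleC_left scaleR_conv_of_real)

lemma bounded_linear_scaleC_left: "bounded_linear (\<lambda>c. c *\<^sub>C (x :: 'a::complex_inner))"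
proof (rule bounded_linear_intro[where K = "norm x"])
  show "(r *\<^sub>R c) *\<^sub>C x = r *\<^sub>R c *\<^sub>C x" for r c
    by (simp add: scaleR_scaleC scaleC_scaleC scaleR_conv_of_real)
qed (simp_all add: scaleC_add_left norm_scaleC)

lemma inner_scaleC_scaleC:
  "inner (c *\<^sub>C x) (d *\<^sub>C y) = Re (c * cnj d * cinner x y)"
  by (simp add: inner_Re_cinner cinner_scaleC_left cinner_scaleC_right mult_ac del: times_complex.sel)

definition orthonormal_on :: "('i \<Rightarrow> 'a::complex_inner) \<Rightarrow> 'i set \<Rightarrow> bool" where
  "orthonormal_on e W \<longleftrightarrow> (\<forall>u\<in>W. \<forall>w\<in>W. cinner (e u) (e w) = (if u = w then 1 else 0))"

lemma orthonormal_onD: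
  "orthonormal_on e W \<Longrightarrow> u \<in> W \<Longrightarrow> w \<in> W \<Longrightarrow> cinner (e u) (e w) = (if u = w then 1 else 0)"
  by (simp add: orthonormal_on_def)

lemma orthonormal_on_subset: "orthonormal_on e W \<Longrightarrow> V \<subseteq> W \<Longrightarrow> orthonormal_on e V"
  by (simp add: orthonormal_on_def subset_iff)

lemma norm_orthonormal_on:
  assumes "orthonormal_on e W" "w \<in> W"
  shows "norm (e w) = 1"
  by (simp add: norm_eq_sqrt_inner inner_Re_cinner orthonormal_onD[OF assms(1) assms(2) assms(2)])

lemma norm_orthonormal_combination:
  assumes "finite W" "orthonormal_on e W"
  shows "(norm (\<Sum>w\<in>W. c w *\<^sub>C e w))\<^sup>2 = (\<Sum>w\<in>W. (cmod (c w))\<^sup>2)"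
proof -
  have "(norm (\<Sum>w\<in>W. c w *\<^sub>C e w))\<^sup>2 = (\<Sum>w\<in>W. (norm (c w *\<^sub>C e w))\<^sup>2)"
    by (rule norm_sum_Pythagorean[OF assms(1)])
       (auto simp: pairwise_def orthogonal_def inner_scaleC_scaleC orthonormal_onD[OF assms(2)])
  thus ?thesis by (simp add: norm_scaleC norm_orthonormal_on[OF assms(2)])
qed

text \<open>The orthogonal projection \<open>p\<close> of \<open>x\<close> to the span of the family
  satisfies \<open>inner x p = (norm p)\<^sup>2\<close>, so the squared norm of
  \<open>x - p\<close>, which is nonnegative, is the difference of the two sides.\<close>

lemma bessel_inequality:
  assumes "finite W" "orthonormal_on e W"
  shows "(\<Sum>w\<in>W. (cmod (cinner x (e w)))\<^sup>2) \<le> (norm x)\<^sup>2"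
proof -
  define p where "p = (\<Sum>w\<in>W. cinner x (e w) *\<^sub>C e w)"
  have p: "(norm p)\<^sup>2 = (\<Sum>w\<in>W. (cmod (cinner x (e w)))\<^sup>2)"
    unfolding p_def by (rule norm_orthonormal_combination[OF assms])
  have "inner x (cinner x (e w) *\<^sub>C e w) = (cmod (cinner x (e w)))\<^sup>2" for w
    unfolding cmod_power2 by (simp add: inner_Re_cinner cinner_scaleC_right power2_eq_square)
  hence "inner x p = (norm p)\<^sup>2" unfolding p by (simp add: p_def inner_sum_right)
  moreover have "0 \<le> (norm (x - p))\<^sup>2" by simp
  ultimately show ?thesis
    unfolding p[symmetric]
    by (simp add: power2_norm_eq_inner inner_diff_left inner_diff_right inner_commute)
qed

text \<open>One Gram-Schmidt step per induction step: by infinite dimensionality some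
  \<open>x\<close> lies outside the span of the vectors found so far, so its component orthogonal to
  them is nonzero and can be normalised.\<close>

lemma exists_orthonormal_card:
  assumes "infinite_dimensional TYPE('h::complex_inner)"
  shows "\<exists>B::'h set. finite B \<and> card B = n \<and> orthonormal_on (\<lambda>b. b) B"
proof (induction n)
  case 0
  show ?case by (rule exI[of _ "{}"]) (simp add: orthonormal_on_def)
next
  case (Suc n)
  interpret V: vector_space "scaleC :: complex \<Rightarrow> 'h \<Rightarrow> 'h" by (rule vector_space_scaleC)
  from Suc obtain B :: "'h set" where B: "finite B" "card B = n" and orth: "orthonormal_on (\<lambda>b. b) B"
    by blast
  obtain x where x: "x \<notin> V.span B"
    using assms B(1) unfolding infinite_dimensional_def by blast
  define p where "p = (\<Sum>b\<in>B. cinner x b *\<^sub>C b)"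
  define z where "z = x - p"
  have "p \<in> V.span B" unfolding p_def by (intro V.span_sum V.span_scale V.span_base)
  hence "z \<noteq> 0" using x by (auto simp: z_def)
  have z_orth: "cinner z b = 0" if "b \<in> B" for b
  proof -
    have "cinner p b = (\<Sum>b'\<in>B. if b' = b then cinner x b' else 0)"
      unfolding p_def cinner_sum_left
      by (intro sum.cong refl) (use that in \<open>simp add: cinner_scaleC_left orthonormal_onD[OF orth]\<close>)
    also have "\<dots> = cinner x b" using that B(1) by simp
    finally have "cinner (z + p) b = cinner z b + cinner x b" by (simp add: cinner_add_left)
    thus ?thesis by (simp add: z_def)
  qed
  have z_orth': "cinner b z = 0" if "b \<in> B" for b
    by (subst cinner_commute) (simp add: z_orth that)
  define y where "y = complex_of_real (inverse (norm z)) *\<^sub>C z"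
  have "cinner z z = complex_of_real ((norm z)\<^sup>2)"
    using cinner_commute[of z z] by (simp add: complex_eq_iff power2_norm_eq_inner inner_Re_cinner)
  hence y: "cinner y y = 1" "\<And>b. b \<in> B \<Longrightarrow> cinner y b = 0" "\<And>b. b \<in> B \<Longrightarrow> cinner b y = 0"
    using \<open>z \<noteq> 0\<close> by (simp_all add: y_def cinner_scaleC_left cinner_scaleC_right z_orth z_orth'
        power2_eq_square field_simps)
  have "y \<notin> B" using y by fastforce
  thus ?case using B orth y by (intro exI[of _ "insert y B"]) (auto simp: orthonormal_on_def)
qed

lemma exists_orthonormal_family:
  assumes "infinite_dimensional TYPE('h::complex_inner)" "finite W"
  shows "\<exists>e :: 'i \<Rightarrow> 'h. orthonormal_on e W"
proof -
  obtain B :: "'h set" where B: "finite B" "card B = card W" "orthonormal_on (\<lambda>b. b) B"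
    using exists_orthonormal_card[OF assms(1)] by blast
  then obtain e where e: "bij_betw e W B"
    using finite_same_card_bij[OF assms(2) B(1)] by auto
  hence "orthonormal_on e W"
    using B(3) unfolding orthonormal_on_def bij_betw_def inj_on_def by auto
  thus ?thesis by blast
qed

section \<open>Row contractions\<close>

lemma cinner_cadjoint:
  "clinear_op X \<Longrightarrow> cinner (blinfun_apply X x) y = cinner x (blinfun_apply (cadjoint X) y)"
  unfolding cadjoint_def using theI'[OF cadjoint_exists] by blast

lemma inner_cadjoint:
  "clinear_op X \<Longrightarrow> inner (blinfun_apply X x) y = inner x (blinfun_apply (cadjoint X) y)"
  by (simp add: inner_Re_cinner cinner_cadjoint)

lemma clinear_op_scaleR:
  assumes "clinear_op X"
  shows "clinear_op (r *\<^sub>R X)"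
proof -
  have "(r *\<^sub>R X) (c *\<^sub>C x) = c *\<^sub>C (r *\<^sub>R X) x" for c x
    using assms unfolding clinear_op_def blinfun.scaleR_left
    by (simp add: scaleR_scaleC scaleC_scaleC mult.commute)
  thus ?thesis by (simp add: clinear_op_def)
qed

lemma clinear_op_word_op:
  assumes "\<And>i. clinear_op (X i)"
  shows "clinear_op (word_op X w)"
  by (induction w) (use assms in \<open>auto simp: clinear_op_def\<close>)

text \<open>Taking adjoints reverses products, so the adjoint of the first letter acts first. This
  is the order in which \<open>fold\<close> runs through the word.\<close>

lemma inner_word_op:
  fixes X :: "'n \<Rightarrow> 'h::complex_hilbert_space \<Rightarrow>\<^sub>L 'h"
  assumes "\<And>i. clinear_op (X i)"
  shows "inner (word_op X w x) y = inner x (fold (\<lambda>i. cadjoint (X i)) w y)"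
  by (induction w arbitrary: y) (simp_all add: inner_cadjoint assms)

lemma row_norm_nonneg: "0 \<le> row_norm X"
  by (simp add: row_norm_def)

lemma row_norm_power2: "(row_norm X)\<^sup>2 = norm (\<Sum>i\<in>UNIV. X i o\<^sub>L cadjoint (X i))"
  by (simp add: row_norm_def)

lemma sum_norm_cadjoint:
  assumes "\<And>i. clinear_op (X i)"
  shows "(\<Sum>i\<in>UNIV. (norm (cadjoint (X i) y))\<^sup>2) = inner (blinfun_apply (\<Sum>i\<in>UNIV. X i o\<^sub>L cadjoint (X i)) y) y"
  by (simp add: blinfun.sum_left inner_sum_left inner_cadjoint[OF assms] power2_norm_eq_inner)

lemma sum_norm_cadjoint_le:
  assumes "\<And>i. clinear_op (X i)"
  shows "(\<Sum>i\<in>UNIV. (norm (cadjoint (X i) y))\<^sup>2) \<le> (row_norm X)\<^sup>2 * (norm y)\<^sup>2"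
proof -
  let ?P = "\<Sum>i\<in>UNIV. X i o\<^sub>L cadjoint (X i)"
  have "inner (?P y) y \<le> norm (?P y) * norm y" by (rule norm_cauchy_schwarz)
  also have "\<dots> \<le> norm ?P * norm y * norm y" by (intro mult_right_mono norm_blinfun) simp
  finally show ?thesis
    unfolding sum_norm_cadjoint[OF assms] row_norm_power2 by (simp add: power2_eq_square mult_ac)
qed

text \<open>A criterion made for creation operators and their truncations. Orthogonality of the
  ranges gives Pythagoras for \<open>P y\<close>, whence the squared norm of \<open>P y\<close> is
  at most \<open>r\<^sup>2 * inner (P y) y\<close>; Cauchy-Schwarz and division by
  \<open>norm (P y)\<close> finish.\<close>

lemma row_norm_le:
  assumes X: "\<And>i. clinear_op (X i)"
    and orth: "\<And>i j x y. i \<noteq> j \<Longrightarrow> inner (blinfun_apply (X i) x) (blinfun_apply (X j) y) = 0"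
    and le: "\<And>i x. norm (blinfun_apply (X i) x) \<le> r * norm x" and "0 \<le> r"
  shows "row_norm X \<le> r"
proof -
  define P where "P = (\<Sum>i\<in>UNIV. X i o\<^sub>L cadjoint (X i))"
  have "norm (P y) \<le> r\<^sup>2 * norm y" for y
  proof (cases "P y = 0")
    case False
    have "(norm (P y))\<^sup>2 = (\<Sum>i\<in>UNIV. (norm (X i (cadjoint (X i) y)))\<^sup>2)"
      unfolding P_def blinfun.sum_left
      by (subst norm_sum_Pythagorean) (auto simp: pairwise_def orthogonal_def orth)
    also have "\<dots> \<le> (\<Sum>i\<in>UNIV. (r * norm (cadjoint (X i) y))\<^sup>2)"
      by (intro sum_mono power_mono le) simp
    also have "\<dots> = r\<^sup>2 * inner (P y) y"
      unfolding P_def sum_norm_cadjoint[OF X, symmetric] by (simp add: power_mult_distrib sum_distrib_left)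
    also have "\<dots> \<le> r\<^sup>2 * (norm (P y) * norm y)" by (intro mult_left_mono norm_cauchy_schwarz) simp
    finally show ?thesis using False by (simp add: power2_eq_square)
  qed (use \<open>0 \<le> r\<close> in simp)
  hence "norm P \<le> r\<^sup>2" by (intro norm_blinfun_bound) simp_all
  thus ?thesis using \<open>0 \<le> r\<close> unfolding row_norm_def P_def by (simp add: real_le_lsqrt)
qed

section \<open>Words of fixed length and homogeneous parts\<close>

lemma finite_words_length [simp]: "finite {w :: 'n::finite list. length w = k}"
  using finite_lists_length_eq[of "UNIV :: 'n set" k] by simp

lemma finite_words_length_le [simp]: "finite {w :: 'n::finite list. length w \<le> k}"
  using finite_lists_length_le[of "UNIV :: 'n set" k] by simp

lemma sum_words_length_Suc:
  fixes f :: "'n::finite list \<Rightarrow> 'b::comm_monoid_add"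
  shows "(\<Sum>w | length w = Suc k. f w) = (\<Sum>i\<in>UNIV. \<Sum>w | length w = k. f (i # w))"
proof -
  have "(\<Sum>w | length w = Suc k. f w) = (\<Sum>(i, w)\<in>UNIV \<times> {w. length w = k}. f (i # w))"
    by (rule sum.reindex_bij_witness[of _ "\<lambda>(i, w). i # w" "\<lambda>w. (hd w, tl w)"])
       (auto simp: length_Suc_conv)
  thus ?thesis by (simp add: sum.cartesian_product)
qed

text \<open>Splitting off the first letter reduces degree \<open>Suc k\<close> to degree
  \<open>k\<close> at the vectors \<open>cadjoint (X i) y\<close>; each letter costs one factor
  \<open>row_norm X\<close>, independently of the number of generators.\<close>

lemma sum_norm_fold_cadjoint_le:
  fixes X :: "'n::finite \<Rightarrow> 'h::complex_hilbert_space \<Rightarrow>\<^sub>L 'h"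
  assumes "\<And>i. clinear_op (X i)"
  shows "(\<Sum>w | length w = k. (norm (fold (\<lambda>i. cadjoint (X i)) w y))\<^sup>2) \<le> (row_norm X ^ k * norm y)\<^sup>2"
proof (induction k arbitrary: y)
  case (Suc k)
  have "(\<Sum>w | length w = Suc k. (norm (fold (\<lambda>i. cadjoint (X i)) w y))\<^sup>2)
      \<le> (\<Sum>i\<in>UNIV. (row_norm X ^ k * norm (cadjoint (X i) y))\<^sup>2)"
    unfolding sum_words_length_Suc by (intro sum_mono) (simp add: Suc.IH)
  also have "\<dots> = (row_norm X ^ k)\<^sup>2 * (\<Sum>i\<in>UNIV. (norm (cadjoint (X i) y))\<^sup>2)"
    by (simp add: power_mult_distrib sum_distrib_left)
  also have "\<dots> \<le> (row_norm X ^ k)\<^sup>2 * ((row_norm X)\<^sup>2 * (norm y)\<^sup>2)"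
    by (intro mult_left_mono sum_norm_cadjoint_le assms) simp
  finally show ?case by (simp add: power_mult_distrib mult_ac)
qed simp

definition coeff_norm :: "'n::finite free_series \<Rightarrow> nat \<Rightarrow> real" where
  "coeff_norm a k = L2_set (\<lambda>w. cmod (a w)) {w. length w = k}"

definition hom_part :: "'n::finite free_series \<Rightarrow> nat \<Rightarrow> ('n \<Rightarrow> 'h \<Rightarrow>\<^sub>L 'h) \<Rightarrow> 'h::complex_hilbert_space \<Rightarrow>\<^sub>L 'h" where
  "hom_part a k X = (\<Sum>w | length w = k. a w *\<^sub>C word_op X w)"

lemma free_eval_conv_hom_part: "free_eval a X = (\<Sum>k. hom_part a k X)"
  by (simp add: free_eval_def hom_part_def)

lemma hom_part_apply: "hom_part a k X x = (\<Sum>w | length w = k. a w *\<^sub>C word_op X w x)"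
  by (simp add: hom_part_def blinfun.sum_left scaleC_blinfun_apply)

lemma hom_part_diff: "hom_part (\<lambda>w. a w - b w) k X = hom_part a k X - hom_part b k X"
proof -
  have "(c - d) *\<^sub>C Y = c *\<^sub>C Y - d *\<^sub>C Y" for c d and Y :: "'a \<Rightarrow>\<^sub>L 'a"
    using scaleC_add_left[of "c - d" d Y] by simp
  thus ?thesis by (simp add: hom_part_def sum_subtractf)
qed

lemma coeff_norm_nonneg [simp]: "0 \<le> coeff_norm a k"
  by (simp add: coeff_norm_def)

text \<open>The value \<open>y\<close> at \<open>x\<close> is paired with itself and the words are
  moved to the other side as adjoints. Cauchy-Schwarz over the words then separates the coefficients
  from the adjoint words, whose square sum is controlled as a whole; bounding the words one by one
  would lose a power of the number of generators.\<close>

lemma norm_hom_part_le: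
  fixes X :: "'n::finite \<Rightarrow> 'h::complex_hilbert_space \<Rightarrow>\<^sub>L 'h"
  assumes X: "\<And>i. clinear_op (X i)"
  shows "norm (hom_part a k X) \<le> coeff_norm a k * row_norm X ^ k"
proof (rule norm_blinfun_bound)
  fix x
  define y where "y = hom_part a k X x"
  define T where "T w = fold (\<lambda>i. cadjoint (X i)) w y" for w
  have "norm y * norm y = inner y y"
    by (simp add: power2_norm_eq_inner flip: power2_eq_square)
  also have "\<dots> = (\<Sum>w | length w = k. inner (a w *\<^sub>C word_op X w x) y)"
    by (subst (1) y_def) (simp only: hom_part_apply inner_sum_left)
  also have "\<dots> = (\<Sum>w | length w = k. inner (a w *\<^sub>C x) (T w))"
    using clinear_op_word_op[of X] X by (simp add: clinear_op_def T_def flip: inner_word_op[OF X])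
  also have "\<dots> \<le> (\<Sum>w | length w = k. norm x * (\<bar>cmod (a w)\<bar> * \<bar>norm (T w)\<bar>))"
    by (intro sum_mono order_trans[OF norm_cauchy_schwarz]) (simp add: norm_scaleC mult_ac)
  also have "\<dots> \<le> norm x * (coeff_norm a k * L2_set (\<lambda>w. norm (T w)) {w. length w = k})"
    unfolding sum_distrib_left[symmetric] coeff_norm_def by (intro mult_left_mono L2_set_mult_ineq) simp
  also have "\<dots> \<le> norm x * (coeff_norm a k * (row_norm X ^ k * norm y))"
    using sum_norm_fold_cadjoint_le[OF X, where k = k and y = y]
    by (intro mult_left_mono) (auto simp: L2_set_def T_def row_norm_nonneg intro!: real_le_lsqrt)
  finally have "norm y * norm y \<le> coeff_norm a k * row_norm X ^ k * norm x * norm y"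
    by (simp add: mult_ac)
  thus "norm (hom_part a k X x) \<le> coeff_norm a k * row_norm X ^ k * norm x"
    unfolding y_def[symmetric]
    by (cases "y = 0") (auto simp: row_norm_nonneg)
qed (simp add: row_norm_nonneg)

section \<open>Coefficient bounds\<close>

definition coeff_bounded :: "'n::finite free_series set \<Rightarrow> bool" where
  "coeff_bounded \<F> \<longleftrightarrow> (\<forall>r\<in>{0..<1}. \<exists>C. \<forall>f\<in>\<F>. \<forall>k. coeff_norm f k * r ^ k \<le> C)"

text \<open>Both inequalities are compared after raising to even powers, which is strictly monotone
  on nonnegative reals.\<close>

lemma powr_root_less_iff:
  fixes c t :: real
  assumes "0 \<le> c" "0 < k" "0 < t"
  shows "c\<^sup>2 powr (1 / (2 * real k)) < t \<longleftrightarrow> c < t ^ k"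
proof -
  define y where "y = c\<^sup>2 powr (1 / (2 * real k))"
  have "y ^ (2 * k) = c\<^sup>2"
  proof (cases "c = 0")
    case False
    hence "y > 0" by (simp add: y_def)
    hence "y ^ (2 * k) = y powr real (2 * k)" by (rule powr_realpow[symmetric])
    also have "\<dots> = c\<^sup>2 powr 1"
      unfolding y_def powr_powr using assms by simp
    finally show ?thesis by simp
  qed (use assms in \<open>simp add: y_def\<close>)
  moreover have "y < t \<longleftrightarrow> y ^ (2 * k) < t ^ (2 * k)"
    using assms unfolding not_le[symmetric] by (subst power_mono_iff) (auto simp: y_def)
  moreover have "c < t ^ k \<longleftrightarrow> c\<^sup>2 < (t ^ k)\<^sup>2"
    using assms unfolding not_le[symmetric] by (subst power_mono_iff) auto
  moreover have "t ^ (2 * k) = (t ^ k)\<^sup>2" by (rule power_even_eq)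
  ultimately show ?thesis by (simp only: y_def)
qed

text \<open>A form of the growth condition without roots. A limsup is at most 1 iff the sequence is
  eventually below every extended real above 1, and by density real bounds suffice.\<close>

lemma free_hol_iff_eventually:
  "a \<in> free_hol \<longleftrightarrow> (\<forall>t>1. \<forall>\<^sub>F k in sequentially. coeff_norm a k < t ^ k)"
proof -
  define L where "L k = ereal ((\<Sum>w | length w = k. (cmod (a w))\<^sup>2) powr (1 / (2 * real k)))" for k
  have L: "L k < ereal t \<longleftrightarrow> coeff_norm a k < t ^ k" if "k > 0" "t > 1" for k t
    using powr_root_less_iff[of "coeff_norm a k" k t] that
    by (simp add: L_def coeff_norm_def L2_set_def sum_nonneg)
  have ev: "(\<forall>\<^sub>F k in sequentially. L k < ereal t) \<longleftrightarrow> (\<forall>\<^sub>F k in sequentially. coeff_norm a k < t ^ k)"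
    if "t > 1" for t
    \<comment> \<open>At \<open>k = 0\<close> the exponent \<open>1 / (2 * real k)\<close> is
      \<open>0\<close> by division by zero, so the equivalence is only taken for positive
      \<open>k\<close>.\<close>
    by (intro eventually_subst eventually_mono[OF eventually_gt_at_top[of 0]]) (use L that in auto)
  have "a \<in> free_hol \<longleftrightarrow> (\<forall>y>1. \<forall>\<^sub>F k in sequentially. L k < y)"
    by (simp add: free_hol_def L_def Limsup_le_iff)
  also have "\<dots> \<longleftrightarrow> (\<forall>t>1. \<forall>\<^sub>F k in sequentially. L k < ereal t)"
  proof safe
    fix y :: ereal
    assume *: "\<forall>t>1. \<forall>\<^sub>F k in sequentially. L k < ereal t" and "1 < y"
    then obtain t where t: "1 < ereal t" "ereal t < y" using ereal_dense2 by blast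
    hence "\<forall>\<^sub>F k in sequentially. L k < ereal t" using * by simp
    thus "\<forall>\<^sub>F k in sequentially. L k < y" by eventually_elim (use t in auto)
  qed simp
  finally show ?thesis using ev by simp
qed

text \<open>The Cauchy-Hadamard criterion for a single series. It makes the estimates for families
  available for individual functions and later shows that a limit is free holomorphic.\<close>

lemma free_hol_iff_coeff_bounded: "a \<in> free_hol \<longleftrightarrow> coeff_bounded {a}"
proof
  assume a: "a \<in> free_hol"
  show "coeff_bounded {a}" unfolding coeff_bounded_def
  proof (intro ballI)
    fix r :: real assume r: "r \<in> {0..<1}"
    \<comment> \<open>The growth rate \<open>t\<close> is the largest that radius \<open>r\<close>
      can absorb; for \<open>r = 0\<close> any number above 1 would do.\<close>
    define t where "t = (if r = 0 then 2 else 1 / r)"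
    have t: "t > 1" "t * r \<le> 1" using r by (auto simp: t_def)
    then obtain N where N: "\<And>k. k \<ge> N \<Longrightarrow> coeff_norm a k < t ^ k"
      using a unfolding free_hol_iff_eventually eventually_sequentially by blast
    \<comment> \<open>The constant 1 covers the degrees from \<open>N\<close> on, the finite sum the
      earlier ones.\<close>
    have "coeff_norm a k * r ^ k \<le> 1 + (\<Sum>j<N. coeff_norm a j * r ^ j)" for k
    proof (cases "k < N")
      case True
      have "coeff_norm a k * r ^ k \<le> (\<Sum>j<N. coeff_norm a j * r ^ j)"
        using r True by (intro member_le_sum) auto
      thus ?thesis by simp
    next
      case False
      hence "coeff_norm a k * r ^ k \<le> t ^ k * r ^ k"
        using N[of k] r by (intro mult_right_mono) auto
      also have "\<dots> \<le> 1" unfolding power_mult_distrib[symmetric] using t r by (intro power_le_one) auto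
      finally show ?thesis using r by (simp add: add_increasing2 sum_nonneg)
    qed
    thus "\<exists>C. \<forall>f\<in>{a}. \<forall>k. coeff_norm f k * r ^ k \<le> C" by blast
  qed
next
  assume a: "coeff_bounded {a}"
  show "a \<in> free_hol" unfolding free_hol_iff_eventually
  proof (intro allI impI)
    fix t :: real assume t: "1 < t"
    \<comment> \<open>Of the two factors \<open>s\<close> in \<open>t\<close>, one compensates the
      radius \<open>1 / s\<close> and the other eventually exceeds the constant
      \<open>C\<close>.\<close>
    define s where "s = sqrt t"
    have s: "1 < s" "t = s * s" using t by (auto simp: s_def)
    then obtain C where C: "\<And>k. coeff_norm a k * (1 / s) ^ k \<le> C"
      using a unfolding coeff_bounded_def by (force dest: bspec[of _ _ "1 / s"])
    obtain N where N: "C < s ^ N" using real_arch_pow[OF s(1)] by blast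
    have "coeff_norm a k < t ^ k" if "k \<ge> N" for k
    proof -
      have "coeff_norm a k \<le> C * s ^ k" using C[of k] s by (simp add: field_simps)
      also have "\<dots> < s ^ k * s ^ k"
        using less_le_trans[OF N power_increasing[OF that]] s by (intro mult_strict_right_mono) auto
      finally show ?thesis by (simp add: s power_mult_distrib)
    qed
    thus "\<forall>\<^sub>F k in sequentially. coeff_norm a k < t ^ k" by (auto simp: eventually_sequentially)
  qed
qed

text \<open>The bound at a radius \<open>t\<close> strictly between \<open>r\<close> and 1 turns
  into geometric decay at \<open>r\<close>, with ratio \<open>r / t\<close>, uniformly over the
  family.\<close>

lemma coeff_bounded_geometric:
  assumes "coeff_bounded \<F>" "0 \<le> r" "r < 1"
  shows "\<exists>C q. 0 \<le> C \<and> 0 \<le> q \<and> q < 1 \<and> (\<forall>f\<in>\<F>. \<forall>k. coeff_norm f k * r ^ k \<le> C * q ^ k)"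
proof -
  define t where "t = (1 + r) / 2"
  have t: "0 < t" "t < 1" "r < t" using assms by (auto simp: t_def)
  then obtain C where C: "\<And>f k. f \<in> \<F> \<Longrightarrow> coeff_norm f k * t ^ k \<le> C"
    using assms(1) unfolding coeff_bounded_def by (metis atLeastLessThan_iff less_imp_le)
  \<comment> \<open>The absolute value is there because \<open>C\<close> may be negative when the
    family is empty.\<close>
  have "coeff_norm f k * r ^ k \<le> \<bar>C\<bar> * (r / t) ^ k" if "f \<in> \<F>" for f k
  proof -
    have "coeff_norm f k * r ^ k = coeff_norm f k * t ^ k * (r / t) ^ k"
      using t by (simp add: power_divide)
    also have "\<dots> \<le> \<bar>C\<bar> * (r / t) ^ k"
      using C[OF that, of k] t assms by (intro mult_right_mono) auto
    finally show ?thesis .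
  qed
  thus ?thesis using t assms by (intro exI[of _ "\<bar>C\<bar>"] exI[of _ "r / t"]) auto
qed

section \<open>Bounds of values by coefficients\<close>

lemma norm_hom_part_le_closed_op_ball:
  assumes "X \<in> closed_op_ball r"
  shows "norm (hom_part a k X) \<le> coeff_norm a k * r ^ k"
proof -
  have "norm (hom_part a k X) \<le> coeff_norm a k * row_norm X ^ k"
    using assms by (intro norm_hom_part_le) (auto simp: closed_op_ball_def)
  also have "\<dots> \<le> coeff_norm a k * r ^ k"
    using assms by (intro mult_left_mono power_mono) (auto simp: closed_op_ball_def row_norm_nonneg)
  finally show ?thesis .
qed

lemma free_hol_summable:
  assumes "a \<in> free_hol" "0 \<le> r" "r < 1"
  shows "summable (\<lambda>k. coeff_norm a k * r ^ k)"
proof -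
  have "coeff_bounded {a}" using assms(1) by (simp only: free_hol_iff_coeff_bounded)
  then obtain C q where C: "0 \<le> q" "q < 1" "\<And>k. coeff_norm a k * r ^ k \<le> C * q ^ k"
    using coeff_bounded_geometric[of "{a}" r] assms(2,3) by auto
  hence "summable (\<lambda>k. C * q ^ k)" by (intro summable_mult summable_geometric) simp
  thus ?thesis
    by (rule summable_comparison_test'[where N = 0]) (use C(3) assms(2) in simp)
qed

lemma summable_hom_part:
  fixes X :: "'n::finite \<Rightarrow> 'h::complex_hilbert_space \<Rightarrow>\<^sub>L 'h"
  assumes "a \<in> free_hol" "X \<in> closed_op_ball r" "0 \<le> r" "r < 1"
  shows "summable (\<lambda>k. hom_part a k X)"
  using free_hol_summable[OF assms(1,3,4)]
  by (rule summable_comparison_test'[where N = 0]) (rule norm_hom_part_le_closed_op_ball[OF assms(2)])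

lemma norm_free_eval_diff_le:
  fixes X :: "'n::finite \<Rightarrow> 'h::complex_hilbert_space \<Rightarrow>\<^sub>L 'h"
  assumes "a \<in> free_hol" "b \<in> free_hol" "X \<in> closed_op_ball r" "0 \<le> r" "r < 1"
    and "summable (\<lambda>k. coeff_norm (\<lambda>w. a w - b w) k * r ^ k)"
  shows "norm (free_eval a X - free_eval b X) \<le> (\<Sum>k. coeff_norm (\<lambda>w. a w - b w) k * r ^ k)"
proof -
  have "free_eval a X - free_eval b X = (\<Sum>k. hom_part (\<lambda>w. a w - b w) k X)"
    unfolding free_eval_conv_hom_part hom_part_diff
    by (intro suminf_diff summable_hom_part[OF _ assms(3-5)] assms)
  thus ?thesis
    using norm_suminf_le[OF norm_hom_part_le_closed_op_ball[OF assms(3)] assms(6)] by simp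
qed

lemma coeff_bounded_imp_free_eval_bounded:
  fixes \<F> :: "'n::finite free_series set"
  assumes "coeff_bounded \<F>" "0 \<le> r" "r < 1"
  shows "\<exists>M>0. \<forall>f\<in>\<F>. \<forall>X\<in>(closed_op_ball r :: ('n \<Rightarrow> 'h::complex_hilbert_space \<Rightarrow>\<^sub>L 'h) set).
           norm (free_eval f X) \<le> M"
proof -
  obtain C q where C: "0 \<le> C" "0 \<le> q" "q < 1"
      "\<And>f k. f \<in> \<F> \<Longrightarrow> coeff_norm f k * r ^ k \<le> C * q ^ k"
    using coeff_bounded_geometric[OF assms] by blast
  have s: "summable (\<lambda>k. C * q ^ k)" using C by (intro summable_mult summable_geometric) auto
  have "norm (free_eval f X) \<le> (\<Sum>k. C * q ^ k)"
    if "f \<in> \<F>" "X \<in> closed_op_ball r" for f and X :: "'n \<Rightarrow> 'h \<Rightarrow>\<^sub>L 'h"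
    unfolding free_eval_conv_hom_part
    by (intro norm_suminf_le s order_trans[OF norm_hom_part_le_closed_op_ball[OF that(2)]] C that)
  moreover have "0 \<le> (\<Sum>k. C * q ^ k)" using C by (intro suminf_nonneg s) auto
  ultimately show ?thesis
    \<comment> \<open>Adding 1 makes the bound strictly positive, as local boundedness
      demands.\<close>
    by (intro exI[of _ "(\<Sum>k. C * q ^ k) + 1"]) (auto intro: add_increasing2)
qed

text \<open>Evaluating at a vector that the words in \<open>X\<close> send to multiples of an orthonormal family
  reads off the coefficients.\<close>

lemma coeff_norm_le_norm_free_eval:
  fixes X :: "'n::finite \<Rightarrow> 'h::complex_hilbert_space \<Rightarrow>\<^sub>L 'h"
  assumes a: "a \<in> free_hol" and X: "X \<in> closed_op_ball r" and r: "0 \<le> r" "r < 1"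
    and v: "norm v \<le> 1" and e: "\<And>u. word_op X u v = complex_of_real (r ^ length u) *\<^sub>C e u"
    and orth: "orthonormal_on e {w. length w = k}"
    and orth': "\<And>u w. length w = k \<Longrightarrow> length u \<noteq> k \<Longrightarrow> cinner (e u) (e w) = 0"
  shows "coeff_norm a k * r ^ k \<le> norm (free_eval a X)"
proof -
  let ?W = "{w :: 'n list. length w = k}"
  define y where "y = free_eval a X v"
  have coeff: "cinner y (e w) = a w * complex_of_real (r ^ k)" if w: "length w = k" for w
  proof -
    have e_w: "cinner (e u) (e w) = (if u = w then 1 else 0)" for u
      by (cases "length u = k") (use w orth' orthonormal_onD[OF orth] in auto)
    have hom: "cinner (hom_part a j X v) (e w) = (if j = k then a w * complex_of_real (r ^ k) else 0)" for j
    proof -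
      have "cinner (hom_part a j X v) (e w)
          = (\<Sum>u | length u = j. if u = w then a w * complex_of_real (r ^ k) else 0)"
        unfolding hom_part_apply cinner_sum_left
        by (intro sum.cong refl)
           (use w in \<open>auto simp: e e_w cinner_scaleC_left\<close>)
      also have "\<dots> = (if w \<in> {u. length u = j} then a w * complex_of_real (r ^ k) else 0)"
        by (rule sum.delta[OF finite_words_length])
      finally show ?thesis using w by auto
    qed
    \<comment> \<open>Evaluation at \<open>v\<close> followed by pairing with \<open>e w\<close> is
      continuous in the operator, so it may be applied term by term; only degree \<open>k\<close>
      survives.\<close>
    have "bounded_linear (\<lambda>A :: 'h \<Rightarrow>\<^sub>L 'h. cinner (A v) (e w))"
      by (intro bounded_linear_compose[OF bounded_linear_cinner_left] blinfun.bounded_linear_left)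
    from bounded_linear.suminf[OF this summable_hom_part[OF a X r]]
    have "cinner y (e w) = (\<Sum>j. cinner (hom_part a j X v) (e w))"
      by (simp add: y_def free_eval_conv_hom_part)
    also have "\<dots> = a w * complex_of_real (r ^ k)"
      unfolding hom using sums_single[of k "\<lambda>_. a w * complex_of_real (r ^ k)"]
      by (simp add: sums_iff eq_commute)
    finally show ?thesis .
  qed
  have "coeff_norm a k * r ^ k = L2_set (\<lambda>w. cmod (cinner y (e w))) ?W"
  proof -
    have "coeff_norm a k * r ^ k = L2_set (\<lambda>w. cmod (a w) * r ^ k) ?W"
      unfolding coeff_norm_def using r by (intro L2_set_left_distrib) simp
    also have "\<dots> = L2_set (\<lambda>w. cmod (cinner y (e w))) ?W"
      using r by (intro L2_set_cong refl) (simp add: coeff norm_mult norm_power)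
    finally show ?thesis .
  qed
  also have "\<dots> \<le> norm y"
    unfolding L2_set_def using bessel_inequality[OF finite_words_length orth, of y]
    by (intro real_le_lsqrt) auto
  also have "\<dots> \<le> norm (free_eval a X) * norm v" unfolding y_def by (rule norm_blinfun)
  also have "\<dots> \<le> norm (free_eval a X)" using v by (simp add: mult_left_le)
  finally show ?thesis .
qed

section \<open>Recovering the coefficients\<close>

text \<open>The standard orthonormal basis of the Fock space; \<open>fock_basis []\<close> is the
  vacuum vector.\<close>

lift_definition fock_basis :: "'n list \<Rightarrow> 'n fock" is "\<lambda>w u. if u = w then 1 else 0"
proof -
  fix w :: "'n list"
  show "(\<lambda>u. (cmod (if u = w then 1 else 0))\<^sup>2) summable_on UNIV"
    by (subst summable_on_cong_neutral[where T = "{w}" and g = "\<lambda>_. 1"]) auto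
qed

lemma cinner_fock_basis: "cinner (fock_basis u) (fock_basis w) = (if u = w then 1 else 0)"
proof -
  have "cinner (fock_basis u) (fock_basis w) = (\<Sum>\<^sub>\<infinity>v\<in>{w}. if u = w then 1 else 0)"
    unfolding cinner_fock_def by (rule infsum_cong_neutral) (auto simp: fock_basis.rep_eq)
  thus ?thesis by simp
qed

lemma fock_tensor_fock_basis: "axis i 1 \<otimes>\<^sub>F fock_basis w = fock_basis (i # w)"
  by (rule fock_eqI) (auto simp: fock_tensor.rep_eq fock_basis.rep_eq axis_def split: list.split)

lemma word_op_left_creation_vacuum:
  "word_op (\<lambda>i. r *\<^sub>R left_creation i) w (fock_basis []) = r ^ length w *\<^sub>R fock_basis w"
  by (induction w)
     (simp_all add: blinfun.scaleR_left blinfun.scaleR_right left_creation_apply fock_tensor_fock_basis)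

text \<open>Left creation operators are isometries with mutually orthogonal ranges, so
  \<open>row_norm_le\<close> applies.\<close>

lemma left_creation_in_closed_op_ball:
  assumes "0 \<le> r"
  shows "(\<lambda>i::'n::finite. r *\<^sub>R left_creation i) \<in> closed_op_ball r"
proof -
  have inner: "inner (blinfun_apply (left_creation i) x) (blinfun_apply (left_creation j) y)
      = (if i = j then inner x y else 0)" for i j :: 'n and x y
  proof -
    have "(\<Sum>k\<in>UNIV. axis i 1 $ k * cnj (axis j 1 $ k)) = (\<Sum>k\<in>UNIV. if k = i then if i = j then 1 else 0 else 0 :: complex)"
      by (intro sum.cong) (auto simp: axis_def)
    thus ?thesis by (simp add: left_creation_apply inner_Re_cinner cinner_fock_tensor)
  qed
  have norm: "norm (blinfun_apply (left_creation i) x) = norm x" for i :: 'n and x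
    by (simp add: norm_eq_sqrt_inner inner)
  have "clinear_op (r *\<^sub>R left_creation i)" for i :: 'n
    by (intro clinear_op_scaleR clinear_left_creation)
  moreover have "row_norm (\<lambda>i::'n. r *\<^sub>R left_creation i) \<le> r"
    using calculation assms by (intro row_norm_le) (auto simp: blinfun.scaleR_left inner norm)
  ultimately show ?thesis by (simp add: closed_op_ball_def)
qed

lemma coeff_norm_le_norm_free_eval_left_creation:
  fixes a :: "'n::finite free_series"
  assumes "a \<in> free_hol" "0 \<le> r" "r < 1"
  shows "coeff_norm a k * r ^ k \<le> norm (free_eval a (\<lambda>i. r *\<^sub>R left_creation i))"
proof (rule coeff_norm_le_norm_free_eval[where v = "fock_basis []" and e = fock_basis])
  show "norm (fock_basis [] :: 'n fock) \<le> 1"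
    by (simp add: norm_eq_sqrt_inner inner_Re_cinner cinner_fock_basis)
  show "word_op (\<lambda>i. r *\<^sub>R left_creation i) u (fock_basis []) = complex_of_real (r ^ length u) *\<^sub>C fock_basis u"
    for u :: "'n list"
    unfolding word_op_left_creation_vacuum by (rule scaleR_scaleC)
qed (use assms in \<open>auto simp: left_creation_in_closed_op_ball orthonormal_on_def cinner_fock_basis\<close>)

text \<open>The analogue of the left creation operators on an orthonormal family indexed by the
  words of length at most \<open>m\<close>, which fits into any infinite dimensional space.\<close>

definition truncated_shift :: "('n list \<Rightarrow> 'h::complex_inner) \<Rightarrow> nat \<Rightarrow> 'n::finite \<Rightarrow> 'h \<Rightarrow>\<^sub>L 'h" where
  "truncated_shift e m i = Blinfun (\<lambda>x. \<Sum>u | length u < m. cinner x (e u) *\<^sub>C e (i # u))"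

lemma finite_words_length_less [simp]: "finite {w :: 'n::finite list. length w < m}"
  by (rule finite_subset[OF _ finite_words_length_le[of m]]) auto

lemma truncated_shift_apply:
  "truncated_shift e m i x = (\<Sum>u | length u < m. cinner x (e u) *\<^sub>C e (i # u))"
  unfolding truncated_shift_def
  by (subst bounded_linear_Blinfun_apply)
     (auto intro!: bounded_linear_sum
       bounded_linear_compose[OF bounded_linear_scaleC_left bounded_linear_cinner_left])

lemma clinear_op_truncated_shift: "clinear_op (truncated_shift e m i)"
proof -
  have "c *\<^sub>C (\<Sum>u\<in>U. f u) = (\<Sum>u\<in>U. c *\<^sub>C f u)" for c U and f :: "'b list \<Rightarrow> 'a"
    by (induction U rule: infinite_finite_induct) (simp_all add: scaleC_add_right)
  thus ?thesis
    by (simp add: clinear_op_def truncated_shift_apply cinner_scaleC_left scaleC_scaleC)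
qed

lemma orthonormal_on_Cons:
  assumes "orthonormal_on e {w. length w \<le> m}"
  shows "orthonormal_on (\<lambda>u. e (i # u)) {u. length u < m}"
  using assms by (simp add: orthonormal_on_def)

text \<open>Different first letters give orthogonal ranges, and Bessel's inequality makes each
  operator a contraction, so \<open>row_norm_le\<close> applies again.\<close>

lemma truncated_shift_in_closed_op_ball:
  fixes e :: "'n::finite list \<Rightarrow> 'h::complex_hilbert_space"
  assumes e: "orthonormal_on e {w. length w \<le> m}" and "0 \<le> r"
  shows "(\<lambda>i. r *\<^sub>R truncated_shift e m i) \<in> closed_op_ball r"
proof -
  let ?V = "{u :: 'n list. length u < m}"
  have orth: "inner (truncated_shift e m i x) (truncated_shift e m j y) = 0" if "i \<noteq> j" for i j x y
    unfolding truncated_shift_apply inner_sum_left inner_sum_right inner_scaleC_scaleC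
    by (intro sum.neutral ballI) (use that in \<open>simp add: orthonormal_onD[OF e]\<close>)
  have le: "norm (truncated_shift e m i x) \<le> norm x" for i x
  proof (rule power2_le_imp_le)
    have "(norm (truncated_shift e m i x))\<^sup>2 = (\<Sum>u\<in>?V. (cmod (cinner x (e u)))\<^sup>2)"
      unfolding truncated_shift_apply
      by (rule norm_orthonormal_combination[OF _ orthonormal_on_Cons[OF e]]) simp
    also have "\<dots> \<le> (norm x)\<^sup>2"
      by (rule bessel_inequality[OF _ orthonormal_on_subset[OF e]]) auto
    finally show "(norm (truncated_shift e m i x))\<^sup>2 \<le> (norm x)\<^sup>2" .
  qed simp
  have "clinear_op (r *\<^sub>R truncated_shift e m i)" for i
    by (intro clinear_op_scaleR clinear_op_truncated_shift)
  moreover have "row_norm (\<lambda>i. r *\<^sub>R truncated_shift e m i) \<le> r"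
    using calculation assms by (intro row_norm_le) (auto simp: blinfun.scaleR_left orth mult_left_mono le)
  ultimately show ?thesis by (simp add: closed_op_ball_def)
qed

lemma word_op_truncated_shift:
  assumes e: "orthonormal_on e {w. length w \<le> m}"
  shows "word_op (\<lambda>i. r *\<^sub>R truncated_shift e m i) w (e [])
      = r ^ length w *\<^sub>R (if length w \<le> m then e w else 0)"
proof (induction w)
  case (Cons i w)
  \<comment> \<open>At \<open>length w = m\<close> the sum contains no term for \<open>w\<close>, so
    the vector is killed and stays zero for all longer words.\<close>
  have "truncated_shift e m i (e w) = (if length w < m then e (i # w) else 0)" if "length w \<le> m"
  proof -
    have "truncated_shift e m i (e w) = (\<Sum>u | length u < m. if u = w then e (i # w) else 0)"
      unfolding truncated_shift_apply
      by (intro sum.cong refl)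
         (use that in \<open>auto simp: orthonormal_onD[OF e] scaleC_one\<close>)
    also have "\<dots> = (if w \<in> {u. length u < m} then e (i # w) else 0)"
      by (rule sum.delta) simp
    finally show ?thesis by simp
  qed
  thus ?case using Cons.IH by (auto simp: blinfun.scaleR_left blinfun.scaleR_right blinfun.zero_right)
qed simp

text \<open>To read off degree \<open>k\<close>, truncation at length \<open>k\<close> suffices:
  shorter words reach vectors orthogonal to those of length \<open>k\<close>, and longer words
  contribute zero.\<close>

lemma coeff_norm_le_of_norm_free_eval_le:
  fixes a :: "'n::finite free_series"
  assumes "infinite_dimensional TYPE('h::complex_hilbert_space)" "a \<in> free_hol" "0 \<le> r" "r < 1"
    and M: "\<And>X. X \<in> (closed_op_ball r :: ('n \<Rightarrow> 'h \<Rightarrow>\<^sub>L 'h) set) \<Longrightarrow> norm (free_eval a X) \<le> M"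
  shows "coeff_norm a k * r ^ k \<le> M"
proof -
  obtain e :: "'n list \<Rightarrow> 'h" where e: "orthonormal_on e {w. length w \<le> k}"
    using exists_orthonormal_family[OF assms(1) finite_words_length_le] by blast
  define X where "X = (\<lambda>i. r *\<^sub>R truncated_shift e k i)"
  have X: "X \<in> closed_op_ball r"
    unfolding X_def by (rule truncated_shift_in_closed_op_ball[OF e \<open>0 \<le> r\<close>])
  have "coeff_norm a k * r ^ k \<le> norm (free_eval a X)"
  proof (rule coeff_norm_le_norm_free_eval[OF assms(2) X assms(3,4),
        where v = "e []" and e = "\<lambda>w. if length w \<le> k then e w else 0"])
    show "norm (e []) \<le> 1" by (simp add: norm_orthonormal_on[OF e])
    show "word_op X u (e []) = complex_of_real (r ^ length u) *\<^sub>C (if length u \<le> k then e u else 0)" for u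
      unfolding X_def word_op_truncated_shift[OF e] by (rule scaleR_scaleC)
    show "orthonormal_on (\<lambda>w. if length w \<le> k then e w else 0) {w. length w = k}"
      using e by (simp add: orthonormal_on_def)
    show "cinner (if length u \<le> k then e u else 0) (if length w \<le> k then e w else 0) = 0"
      if "length w = k" "length u \<noteq> k" for u w
      using that by (auto simp: orthonormal_onD[OF e])
  qed
  also have "\<dots> \<le> M" by (rule M[OF X])
  finally show ?thesis .
qed

section \<open>Bounded values versus bounded coefficients\<close>

lemma coeff_bounded_iff_free_eval_left_creation:
  fixes \<F> :: "'n::finite free_series set"
  assumes "\<F> \<subseteq> free_hol"
  shows "coeff_bounded \<F> \<longleftrightarrow>
    (\<forall>r\<in>{0..<1}. (SUP f\<in>\<F>. ereal (norm (free_eval f (\<lambda>i. r *\<^sub>R left_creation i)))) < \<infinity>)"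
proof safe
  fix r :: real assume cb: "coeff_bounded \<F>" and r: "r \<in> {0..<1}"
  obtain M where "\<And>f X. f \<in> \<F> \<Longrightarrow> X \<in> (closed_op_ball r :: ('n \<Rightarrow> 'n fock \<Rightarrow>\<^sub>L 'n fock) set)
      \<Longrightarrow> norm (free_eval f X) \<le> M"
    using coeff_bounded_imp_free_eval_bounded[OF cb] r by (metis atLeastLessThan_iff)
  hence "(SUP f\<in>\<F>. ereal (norm (free_eval f (\<lambda>i. r *\<^sub>R left_creation i)))) \<le> ereal M"
    using r by (intro SUP_least) (auto simp: left_creation_in_closed_op_ball)
  thus "(SUP f\<in>\<F>. ereal (norm (free_eval f (\<lambda>i. r *\<^sub>R left_creation i)))) < \<infinity>"
    by (rule le_less_trans) simp
next
  assume *: "\<forall>r\<in>{0..<1}. (SUP f\<in>\<F>. ereal (norm (free_eval f (\<lambda>i. r *\<^sub>R left_creation i)))) < \<infinity>"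
  show "coeff_bounded \<F>" unfolding coeff_bounded_def
  proof
    fix r :: real assume r: "r \<in> {0..<1}"
    define s where "s = (SUP f\<in>\<F>. ereal (norm (free_eval f (\<lambda>i. r *\<^sub>R left_creation i))))"
    have le: "ereal (norm (free_eval f (\<lambda>i. r *\<^sub>R left_creation i))) \<le> s" if "f \<in> \<F>" for f
      unfolding s_def by (rule SUP_upper[OF that])
    have "s < \<infinity>" using * r unfolding s_def by blast
    have "coeff_norm f k * r ^ k \<le> real_of_ereal s" if "f \<in> \<F>" for f k
    proof -
      have "coeff_norm f k * r ^ k \<le> norm (free_eval f (\<lambda>i. r *\<^sub>R left_creation i))"
        using that assms r by (intro coeff_norm_le_norm_free_eval_left_creation) auto
      also have "\<dots> \<le> real_of_ereal s"
        \<comment> \<open>The value minus infinity of \<open>s\<close>, the supremum over an empty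
          family, is excluded by the member \<open>f\<close>.\<close>
        using le[OF that] \<open>s < \<infinity>\<close> by (cases s) auto
      finally show ?thesis .
    qed
    thus "\<exists>C. \<forall>f\<in>\<F>. \<forall>k. coeff_norm f k * r ^ k \<le> C" by blast
  qed
qed

lemma coeff_bounded_iff_locally_bounded:
  fixes \<F> :: "'n::finite free_series set"
  assumes "infinite_dimensional TYPE('h::complex_hilbert_space)" "\<F> \<subseteq> free_hol"
  shows "coeff_bounded \<F> \<longleftrightarrow> locally_bounded TYPE('h) \<F>"
proof
  assume "coeff_bounded \<F>"
  thus "locally_bounded TYPE('h) \<F>"
    unfolding locally_bounded_def
  proof (intro ballI)
    fix r :: real assume "coeff_bounded \<F>" "r \<in> {0..<1}"
    then obtain M where M: "M > 0" "\<forall>f\<in>\<F>. \<forall>X\<in>(closed_op_ball r :: ('n \<Rightarrow> 'h \<Rightarrow>\<^sub>L 'h) set). norm (free_eval f X) \<le> M"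
      using coeff_bounded_imp_free_eval_bounded by (metis atLeastLessThan_iff)
    have "open_op_ball r \<subseteq> (closed_op_ball r :: ('n \<Rightarrow> 'h \<Rightarrow>\<^sub>L 'h) set)"
      by (auto simp: open_op_ball_def closed_op_ball_def)
    thus "\<exists>M>0. \<forall>f\<in>\<F>. \<forall>X\<in>(open_op_ball r :: ('n \<Rightarrow> 'h \<Rightarrow>\<^sub>L 'h) set). norm (free_eval f X) \<le> M"
      using M by blast
  qed
next
  assume lb: "locally_bounded TYPE('h) \<F>"
  show "coeff_bounded \<F>" unfolding coeff_bounded_def
  proof
    fix r :: real assume r: "r \<in> {0..<1}"
    \<comment> \<open>Local boundedness speaks of open balls; the one of the larger radius
      \<open>t\<close> contains the closed ball of radius \<open>r\<close>.\<close>
    define t where "t = (1 + r) / 2"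
    have t: "t \<in> {0..<1}" "r < t" using r by (auto simp: t_def)
    obtain M where M: "\<And>f X. f \<in> \<F> \<Longrightarrow> X \<in> (open_op_ball t :: ('n \<Rightarrow> 'h \<Rightarrow>\<^sub>L 'h) set) \<Longrightarrow> norm (free_eval f X) \<le> M"
      using lb t(1) unfolding locally_bounded_def by blast
    have "closed_op_ball r \<subseteq> (open_op_ball t :: ('n \<Rightarrow> 'h \<Rightarrow>\<^sub>L 'h) set)"
      using t(2) by (auto simp: open_op_ball_def closed_op_ball_def)
    hence "coeff_norm f k * r ^ k \<le> M" if "f \<in> \<F>" for f k
      using r M that assms(2) by (intro coeff_norm_le_of_norm_free_eval_le[OF assms(1)]) auto
    thus "\<exists>C. \<forall>f\<in>\<F>. \<forall>k. coeff_norm f k * r ^ k \<le> C" by blast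
  qed
qed

section \<open>Normality\<close>

lemma coeff_norm_diff_le: "coeff_norm (\<lambda>w. a w - b w) k \<le> coeff_norm a k + coeff_norm b k"
proof -
  have "coeff_norm (\<lambda>w. a w - b w) k \<le> L2_set (\<lambda>w. cmod (a w) + cmod (b w)) {w. length w = k}"
    unfolding coeff_norm_def by (intro L2_set_mono norm_triangle_ineq4) simp
  also have "\<dots> \<le> coeff_norm a k + coeff_norm b k"
    unfolding coeff_norm_def by (rule L2_set_triangle_ineq)
  finally show ?thesis .
qed

lemma cmod_le_coeff_norm: "cmod (a w) \<le> coeff_norm a (length w)"
  unfolding coeff_norm_def by (rule member_le_L2_set) simp_all

lemma tendsto_coeff_norm:
  assumes "\<And>w. ((\<lambda>n. f n w) \<longlongrightarrow> g w) F"
  shows "((\<lambda>n. coeff_norm (f n) k) \<longlongrightarrow> coeff_norm g k) F"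
  unfolding coeff_norm_def L2_set_def by (intro tendsto_intros assms)

text \<open>Each \<open>coeff_norm\<close> involves finitely many coefficients and hence is
  continuous under coefficientwise convergence, so the limit inherits the bounds of the
  family.\<close>

lemma coeff_bounded_insert_limit:
  assumes cb: "coeff_bounded \<F>" and f: "range f \<subseteq> \<F>" and lim: "\<And>w. (\<lambda>n. f n w) \<longlonglongrightarrow> g w"
  shows "coeff_bounded (insert g \<F>)"
  unfolding coeff_bounded_def
proof
  fix r :: real assume "r \<in> {0..<1}"
  then obtain C where C: "\<And>f k. f \<in> \<F> \<Longrightarrow> coeff_norm f k * r ^ k \<le> C"
    using cb unfolding coeff_bounded_def by blast
  have "coeff_norm g k * r ^ k \<le> C" for k
    by (rule LIMSEQ_le_const2[OF tendsto_mult_right[OF tendsto_coeff_norm[OF lim]]]) (use C f in blast)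
  thus "\<exists>C. \<forall>f\<in>insert g \<F>. \<forall>k. coeff_norm f k * r ^ k \<le> C" using C by blast
qed

lemma coeff_bounded_convergent_subsequence:
  fixes f :: "nat \<Rightarrow> 'n::finite free_series"
  assumes "coeff_bounded \<F>" "range f \<subseteq> \<F>"
  obtains s g where "strict_mono (s :: nat \<Rightarrow> nat)" "\<And>w. (\<lambda>n. f (s n) w) \<longlonglongrightarrow> g w"
proof -
  obtain C where C: "\<And>f k. f \<in> \<F> \<Longrightarrow> coeff_norm f k * (1 / 2) ^ k \<le> C"
    using assms(1) unfolding coeff_bounded_def by (force dest: bspec[of _ _ "1 / 2"])
  \<comment> \<open>The diagonal argument is applied with one bound for all words. Scaling by
    \<open>1 / 2 ^ length w\<close> provides it, from the coefficient bound at radius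
    \<open>1 / 2\<close>, and is undone afterwards.\<close>
  have "cmod (f n w / 2 ^ length w) \<le> C" for n w
  proof -
    have "cmod (f n w / 2 ^ length w) \<le> coeff_norm (f n) (length w) * (1 / 2) ^ length w"
      using cmod_le_coeff_norm[of "f n" w] by (simp add: norm_divide norm_power power_divide divide_right_mono)
    also have "\<dots> \<le> C" using assms(2) by (intro C) auto
    finally show ?thesis .
  qed
  then obtain s where s: "strict_mono (s :: nat \<Rightarrow> nat)"
      and "\<And>w. \<exists>l. (\<lambda>n. f (s n) w / 2 ^ length w) \<longlonglongrightarrow> l"
    by (metis UNIV_I countableI_type
        function_convergent_subsequence[of UNIV "\<lambda>n w. f n w / 2 ^ length w" C])
  then obtain l where "\<And>w. (\<lambda>n. f (s n) w / 2 ^ length w) \<longlonglongrightarrow> l w" by metis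
  hence "(\<lambda>n. f (s n) w / 2 ^ length w * 2 ^ length w) \<longlonglongrightarrow> l w * 2 ^ length w" for w
    by (rule tendsto_mult_right)
  hence "(\<lambda>n. f (s n) w) \<longlonglongrightarrow> l w * 2 ^ length w" for w by simp
  with s show thesis by (rule that)
qed

text \<open>On the whole ball the distance is at most the series of the \<open>D k n\<close> over
  \<open>k\<close>, which does not depend on the point. Its terms tend to 0 for each
  \<open>k\<close> and have a geometric majorant independent of \<open>n\<close>, so its sum tends
  to 0.\<close>

lemma uniform_limit_free_eval:
  fixes f :: "nat \<Rightarrow> 'n::finite free_series"
  assumes cb: "coeff_bounded \<F>" and f: "range f \<subseteq> \<F>" and lim: "\<And>w. (\<lambda>n. f n w) \<longlonglongrightarrow> g w"
    and r: "0 \<le> r" "r < 1"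
  shows "uniform_limit (closed_op_ball r :: ('n \<Rightarrow> 'h::complex_hilbert_space \<Rightarrow>\<^sub>L 'h) set)
           (\<lambda>n. free_eval (f n)) (free_eval g) sequentially"
proof (rule uniform_limitI)
  fix e :: real assume "e > 0"
  have cb': "coeff_bounded (insert g \<F>)" by (rule coeff_bounded_insert_limit[OF cb f lim])
  hence hol: "a \<in> free_hol" if "a \<in> insert g \<F>" for a
    using that unfolding free_hol_iff_coeff_bounded coeff_bounded_def by blast
  obtain C q where C: "0 \<le> q" "q < 1"
      "\<And>f k. f \<in> insert g \<F> \<Longrightarrow> coeff_norm f k * r ^ k \<le> C * q ^ k"
    using coeff_bounded_geometric[OF cb' r] by blast
  define D where "D k n = coeff_norm (\<lambda>w. f n w - g w) k * r ^ k" for k n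
  have D_le: "norm (D k n) \<le> 2 * C * q ^ k" for k n
  proof -
    have "norm (D k n) = D k n" using r by (simp add: D_def)
    also have "\<dots> \<le> coeff_norm (f n) k * r ^ k + coeff_norm g k * r ^ k"
      using coeff_norm_diff_le[of "f n" g k] r
      unfolding D_def distrib_right[symmetric] by (intro mult_right_mono) auto
    also have "\<dots> \<le> 2 * C * q ^ k" using C(3)[of "f n" k] C(3)[of g k] range_subsetD[OF f, of n] by simp
    finally show ?thesis .
  qed
  have sum_q: "summable (\<lambda>k. 2 * C * q ^ k)" using C by (intro summable_mult summable_geometric) auto
  have sum_D: "summable (\<lambda>k. D k n)" for n
    by (rule summable_comparison_test'[OF sum_q]) (rule D_le)
  have "(\<lambda>n. coeff_norm (\<lambda>w. f n w - g w) k) \<longlonglongrightarrow> coeff_norm (\<lambda>w. g w - g w) k" for k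
    by (intro tendsto_coeff_norm tendsto_intros lim)
  hence "(\<lambda>n. D k n) \<longlonglongrightarrow> 0 * r ^ k" for k
    unfolding D_def by (intro tendsto_mult_right) (simp add: coeff_norm_def L2_set_def)
  hence D_lim: "(\<lambda>n. D k n) \<longlonglongrightarrow> 0" for k by simp
  have "\<forall>\<^sub>F (k, n) in sequentially \<times>\<^sub>F sequentially. norm (D k n) \<le> 2 * C * q ^ k"
    using D_le by (intro always_eventually) auto
  \<comment> \<open>Tannery's theorem is dominated convergence for series.\<close>
  hence "(\<lambda>n. \<Sum>k. D k n) \<longlonglongrightarrow> (\<Sum>k. 0)"
    using tannerys_theorem[OF D_lim _ sum_q] by simp
  hence "\<forall>\<^sub>F n in sequentially. (\<Sum>k. D k n) < e"
    using \<open>e > 0\<close> by (intro order_tendstoD) auto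
  thus "\<forall>\<^sub>F n in sequentially. \<forall>X\<in>(closed_op_ball r :: ('n \<Rightarrow> 'h \<Rightarrow>\<^sub>L 'h) set).
          dist (free_eval (f n) X) (free_eval g X) < e"
  proof eventually_elim
    case (elim n)
    have "dist (free_eval (f n) X) (free_eval g X) \<le> (\<Sum>k. D k n)"
      if "X \<in> closed_op_ball r" for X :: "'n \<Rightarrow> 'h \<Rightarrow>\<^sub>L 'h"
      using f sum_D[of n] unfolding dist_norm D_def
      by (intro norm_free_eval_diff_le[OF _ _ that r] hol) auto
    thus ?case using elim by fastforce
  qed
qed

lemma coeff_bounded_imp_normal_family:
  fixes \<F> :: "'n::finite free_series set"
  assumes cb: "coeff_bounded \<F>"
  shows "normal_family TYPE('h::complex_hilbert_space) \<F>"
  unfolding normal_family_def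
proof (intro allI impI)
  fix f :: "nat \<Rightarrow> 'n free_series" assume f: "range f \<subseteq> \<F>"
  obtain s g where s: "strict_mono (s :: nat \<Rightarrow> nat)" and lim: "\<And>w. (\<lambda>n. f (s n) w) \<longlonglongrightarrow> g w"
    using coeff_bounded_convergent_subsequence[OF cb f] by blast
  have fs: "range (\<lambda>n. f (s n)) \<subseteq> \<F>" using f by auto
  have "g \<in> free_hol"
    using coeff_bounded_insert_limit[OF cb fs lim]
    unfolding free_hol_iff_coeff_bounded coeff_bounded_def by blast
  with s show "\<exists>s g. strict_mono (s :: nat \<Rightarrow> nat) \<and> g \<in> free_hol \<and>
      (\<forall>r\<in>{0..<1}. uniform_limit (closed_op_ball r :: ('n \<Rightarrow> 'h \<Rightarrow>\<^sub>L 'h) set)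
         (\<lambda>k. free_eval (f (s k))) (free_eval g) sequentially)"
    using uniform_limit_free_eval[OF cb fs lim] by (intro exI[of _ s] exI[of _ g]) auto
qed

text \<open>Otherwise there are members \<open>f n\<close> and points \<open>X n\<close> of one ball
  with values larger than \<open>Suc n\<close>. Along a convergent subsequence the values are
  eventually within distance 1 of those of the limit, which is bounded on that ball.\<close>

lemma normal_family_imp_locally_bounded:
  fixes \<F> :: "'n::finite free_series set"
  assumes normal: "normal_family TYPE('h::complex_hilbert_space) \<F>"
  shows "locally_bounded TYPE('h) \<F>"
proof (rule ccontr)
  assume "\<not> locally_bounded TYPE('h) \<F>"
  then obtain r where r: "r \<in> {0..<1}"
    and "\<And>M. M > 0 \<Longrightarrow> \<exists>f\<in>\<F>. \<exists>X\<in>(open_op_ball r :: ('n \<Rightarrow> 'h \<Rightarrow>\<^sub>L 'h) set). M < norm (free_eval f X)"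
    unfolding locally_bounded_def by (meson not_le)
  hence "\<exists>f\<in>\<F>. \<exists>X\<in>(open_op_ball r :: ('n \<Rightarrow> 'h \<Rightarrow>\<^sub>L 'h) set). real (Suc n) < norm (free_eval f X)" for n
    by simp
  then obtain f and X :: "nat \<Rightarrow> 'n \<Rightarrow> 'h \<Rightarrow>\<^sub>L 'h" where f: "\<And>n. f n \<in> \<F>"
    and X: "\<And>n. X n \<in> open_op_ball r" and large: "\<And>n. real (Suc n) < norm (free_eval (f n) (X n))"
    by metis
  have X': "X n \<in> closed_op_ball r" for n
    using X[of n] by (auto simp: open_op_ball_def closed_op_ball_def)
  obtain s g where s: "strict_mono (s :: nat \<Rightarrow> nat)" and g: "g \<in> free_hol"
    and lim: "uniform_limit (closed_op_ball r :: ('n \<Rightarrow> 'h \<Rightarrow>\<^sub>L 'h) set)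
         (\<lambda>k. free_eval (f (s k))) (free_eval g) sequentially"
    using normal f r unfolding normal_family_def by (meson image_subsetI)
  obtain M where M: "\<And>X. X \<in> (closed_op_ball r :: ('n \<Rightarrow> 'h \<Rightarrow>\<^sub>L 'h) set) \<Longrightarrow> norm (free_eval g X) \<le> M"
    using coeff_bounded_imp_free_eval_bounded[of "{g}" r] g r
    by (auto simp: free_hol_iff_coeff_bounded)
  have "\<forall>\<^sub>F n in sequentially. \<forall>X\<in>(closed_op_ball r :: ('n \<Rightarrow> 'h \<Rightarrow>\<^sub>L 'h) set).
      dist (free_eval (f (s n)) X) (free_eval g X) < 1"
    using lim unfolding uniform_limit_iff by simp
  moreover have "\<forall>\<^sub>F n in sequentially. M < real n"
    using filterlim_real_sequentially by (simp add: filterlim_at_top_dense)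
  ultimately have "\<forall>\<^sub>F n in sequentially. False"
  proof eventually_elim
    case (elim n)
    have "norm (free_eval (f (s n)) (X (s n))) \<le> norm (free_eval g (X (s n))) + 1"
      using elim(1) X'[of "s n"] norm_triangle_sub[of "free_eval (f (s n)) (X (s n))" "free_eval g (X (s n))"]
      by (fastforce simp: dist_norm)
    also have "\<dots> \<le> M + 1" using M[OF X'[of "s n"]] by simp
    \<comment> \<open>A strictly increasing \<open>s\<close> satisfies \<open>n \<le> s n\<close>,
      so the values grow along the subsequence too.\<close>
    also have "\<dots> < real (Suc (s n))" using elim(2) seq_suble[OF s, of n] by simp
    finally show False using large[of "s n"] by simp
  qed
  thus False by simp
qed

theorem theorem5p2:
  fixes \<F> :: "'n::finite free_series set"
  assumes "infinite_dimensional TYPE('h::complex_hilbert_space)"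
    and "\<F> \<subseteq> free_hol"
  shows "((\<forall>r\<in>{0..<1}. (SUP f\<in>\<F>. ereal (norm (free_eval f (\<lambda>i. r *\<^sub>R left_creation i)))) < \<infinity>)
            \<longleftrightarrow> normal_family TYPE('h) \<F>)
       \<and> (normal_family TYPE('h) \<F> \<longleftrightarrow> locally_bounded TYPE('h) \<F>)"
  \<comment> \<open>The conditions on creation operators and on local boundedness both become
    \<open>coeff_bounded\<close>. This implies normality, which in turn implies local
    boundedness.\<close>
  unfolding coeff_bounded_iff_free_eval_left_creation[OF assms(2), symmetric]
    coeff_bounded_iff_locally_bounded[OF assms, symmetric]
  using coeff_bounded_imp_normal_family normal_family_imp_locally_bounded
    coeff_bounded_iff_locally_bounded[OF assms]
  by blast

end
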